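(* Fix $n$. Let $\rho(\cdot,y)$ be convex for each $y\in\{0,1\}$ and satisfy the Lipschitz condition: there is $L>0$ such that $|\rho(b_1,y)-\rho(b_2,y)|\le L|b_1-b_2|$ for all $b_1,b_2\in\mathbb{R}$, $y\in\{0,1\}$. Assume that $X_{ij}\sim Subg(\sigma_{jn}^2)$ for $j=1,\dots,p_n$, that $\beta^*$ exists and is unique, and that the following margin condition holds for some $\varepsilon,\delta,\vartheta>0$ and some non-negative definite matrix $H\in\mathbb{R}^{p_n\times p_n}$: for all $b$ with $b-\beta^*\in\mathcal{C}_\varepsilon\cap B_1(\delta)$, $$R(b)-R(\beta^* )\ge\frac{\vartheta}{2}(b-\beta^* )^TH(b-\beta^* ).$$ Let $\lambda>0$ be such that $$\frac{2|s^*|\lambda}{\vartheta\kappa_H(\varepsilon)}\le\tilde C\min\left\{\frac{\beta^*_{min}}{2},\delta\right\},\qquad \tilde C=\frac{2}{4+\varepsilon}.$$ Then $$P\left(\|\hat\beta_L-\beta^*\|_1\le\frac{\beta^*_{min}}{2}\right)\ge 1-\frac{8(8+2\varepsilon)Ls_n\sqrt{\log(p_n\vee2)}}{\varepsilon\lambda\sqrt n}.$$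
   Context: $(X,Y)$ is a random element of $\mathbb{R}^{p_n}\times\{0,1\}$ (its law may depend on $n$) and $(X_i,Y_i)$, $i=1,\dots,n$, are iid copies of it, $X_i=(X_{i1},\dots,X_{ip_n})^T$. A random variable $Z$ is $Subg(\sigma^2)$ if $E\exp(tZ)\le\exp(t^2\sigma^2/2)$ for all $t\in\mathbb{R}$. $s_n=\max_{1\le j\le p_n}\sigma_{jn}$. Standing assumption: the coordinates of $X$ are linearly independent in the sense that no nontrivial linear combination of them is almost surely constant. For $\rho:\mathbb{R}\times\{0,1\}\to\mathbb{R}$ the risk and the empirical risk are $R(b)=E\rho(b^TX,Y)$ and $R_n(b)=\frac1n\sum_{i=1}^n\rho(b^TX_i,Y_i)$, $b\in\mathbb{R}^{p_n}$. $\beta^*=\arg\min_{b\in\mathbb{R}^{p_n}}R(b)$, $s^*=\{i:\beta^*_i\ne0\}$, $s^{*c}=\{1,\dots,p_n\}\setminus s^*$, $\beta^*_{min}=\min_{i\in s^*}|\beta^*_i|$. The Lasso estimator with penalty $\lambda>0$ is $\hat\beta_L=\arg\min_{b\in\mathbb{R}^{p_n}}\{R_n(b)+\lambda\|b\|_1\}$. $v_\pi$ denotes the restriction of $v$ to the coordinates in $\pi$. $\mathcal{C}_\varepsilon=\{\Delta\in\mathbb{R}^{p_n}:\|\Delta_{s^{*c}}\|_1\le(3+\varepsilon)\|\Delta_{s^*}\|_1\}$, $B_1(r)=\{\Delta\in\mathbb{R}^{p_n}:\|\Delta\|_1\le r\}$, and $$\kappa_H(\varepsilon)=\inf_{\Delta\in\mathcal{C}_\varepsilon\setminus\{0\}}\frac{\Delta^TH\Delta}{\Delta^T\Delta}.$$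 Conventions: infima and minima over the empty set are $+\infty$; a ratio with positive numerator and denominator $0$ is $+\infty$ (so for $s^*\neq\emptyset$ the assumed inequality requires $\kappa_H(\varepsilon)>0$). $a\vee b=\max(a,b)$. *)

theory Defs
  imports "HOL-Probability.Probability"
begin

(* Integrability is demanded explicitly: the Bochner integral of a non-integrable
   function is 0, which would satisfy the bound vacuously. *)
definition subgaussian :: "'a measure \<Rightarrow> real \<Rightarrow> ('a \<Rightarrow> real) \<Rightarrow> bool" where
  "subgaussian M v Z \<longleftrightarrow>
     (\<forall>t. integrable M (\<lambda>\<omega>. exp (t * Z \<omega>)) \<and>
          (\<integral>\<omega>. exp (t * Z \<omega>) \<partial>M) \<le> exp (t\<^sup>2 * v / 2))"

definition l1_norm_on :: "'p set \<Rightarrow> real ^ 'p \<Rightarrow> real" where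
  "l1_norm_on S v = (\<Sum>j\<in>S. \<bar>v $ j\<bar>)"

abbreviation l1_norm :: "real ^ 'p \<Rightarrow> real" where
  "l1_norm v \<equiv> l1_norm_on UNIV v"

definition l1_ball :: "real \<Rightarrow> (real ^ 'p) set" where
  "l1_ball r = {\<Delta>. l1_norm \<Delta> \<le> r}"

definition supp :: "real ^ 'p \<Rightarrow> 'p set" where
  "supp b = {j. b $ j \<noteq> 0}"

(* Extended reals, so that the minimum is \<infinity> when the support is empty. *)
definition min_signal :: "real ^ 'p \<Rightarrow> ereal" where
  "min_signal b = (INF j\<in>supp b. ereal \<bar>b $ j\<bar>)"

definition lasso_cone :: "'p set \<Rightarrow> real \<Rightarrow> (real ^ 'p) set" where
  "lasso_cone S \<epsilon> = {\<Delta>. l1_norm_on (- S) \<Delta> \<le> (3 + \<epsilon>) * l1_norm_on S \<Delta>}"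

(* Symmetry is not required: only the quadratic form of H matters. *)
definition nonneg_definite :: "real ^ 'p ^ 'p \<Rightarrow> bool" where
  "nonneg_definite H \<longleftrightarrow> (\<forall>v. 0 \<le> v \<bullet> (H *v v))"

definition kappa :: "real ^ 'p ^ 'p \<Rightarrow> 'p set \<Rightarrow> real \<Rightarrow> ereal" where
  "kappa H S \<epsilon> =
     (INF \<Delta>\<in>lasso_cone S \<epsilon> - {0}. ereal ((\<Delta> \<bullet> (H *v \<Delta>)) / (\<Delta> \<bullet> \<Delta>)))"

definition risk ::
  "'a measure \<Rightarrow> (real \<Rightarrow> nat \<Rightarrow> real) \<Rightarrow> ('a \<Rightarrow> real ^ 'p) \<Rightarrow> ('a \<Rightarrow> nat) \<Rightarrow> real ^ 'p \<Rightarrow> real" where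
  "risk M \<rho> X Y b = (\<integral>\<omega>. \<rho> (b \<bullet> X \<omega>) (Y \<omega>) \<partial>M)"

definition emp_risk ::
  "(real \<Rightarrow> nat \<Rightarrow> real) \<Rightarrow> nat \<Rightarrow> (nat \<Rightarrow> real ^ 'p) \<Rightarrow> (nat \<Rightarrow> nat) \<Rightarrow> real ^ 'p \<Rightarrow> real" where
  "emp_risk \<rho> n xs ys b = (\<Sum>i=1..n. \<rho> (b \<bullet> xs i) (ys i)) / real n"

definition is_lasso ::
  "(real \<Rightarrow> nat \<Rightarrow> real) \<Rightarrow> real \<Rightarrow> nat \<Rightarrow> (nat \<Rightarrow> real ^ 'p) \<Rightarrow> (nat \<Rightarrow> nat) \<Rightarrow> real ^ 'p \<Rightarrow> bool" where
  "is_lasso \<rho> lam n xs ys b \<longleftrightarrow>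
     is_arg_min (\<lambda>b. emp_risk \<rho> n xs ys b + lam * l1_norm b) (\<lambda>_. True) b"

(* The space of one observation; measurability into count_space {0, 1} forces the
   label to lie in {0, 1}. *)
abbreviation obs_space :: "((real ^ 'p::finite) \<times> nat) measure" where
  "obs_space \<equiv> borel \<Otimes>\<^sub>M count_space {0, 1}"

definition iid_copies ::
  "'a measure \<Rightarrow> 'b measure \<Rightarrow> ('a \<Rightarrow> 'b) \<Rightarrow> nat \<Rightarrow> (nat \<Rightarrow> 'a \<Rightarrow> 'b) \<Rightarrow> bool" where
  "iid_copies M N Z n Zs \<longleftrightarrow>
     Z \<in> measurable M N \<and>
     prob_space.indep_vars M (\<lambda>_. N) Zs {1..n} \<and>
     (\<forall>i\<in>{1..n}. distr M N (Zs i) = distr M N Z)"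

end

theory Submission
  imports Defs
begin

text \<open>
  Put \<open>r = min (\<beta>\<^sub>m\<^sub>i\<^sub>n / 2) \<delta>\<close>. If the one-sided deviation
  \<open>(R b - R \<beta>) - (R\<^sub>n b - R\<^sub>n \<beta>)\<close> is at most \<open>\<epsilon> \<lambda> r / (8 + 2 \<epsilon>)\<close> on the \<open>\<ell>\<^sub>1\<close>-ball of radius \<open>r\<close>
  around \<open>\<beta>\<close>, then the penalised empirical risk is larger on the sphere of radius \<open>r\<close> than at \<open>\<beta>\<close>.
  By convexity a Lasso solution exists and every solution lies in that ball.

  The supremum of the deviation is controlled through its exponential moment. The observations are
  replaced one at a time: symmetrization followed by the contraction principle turns the loss into the
  linear functional \<open>b \<bullet> X\<close>, and the linear process is bounded by the coordinates of the sum of the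
  \<open>\<plusminus>X\<^sub>i\<close>. All suprema are taken in the extended nonnegative reals, so that no boundedness or
  integrability of suprema has to be shown. The resulting tail \<open>2 p exp (- u\<^sup>2 / 8)\<close> with
  \<open>u = \<epsilon> \<lambda> \<surd>n / ((8 + 2 \<epsilon>) L s)\<close> is stronger than the claimed \<open>8 \<surd>(ln (max p 2)) / u\<close>.
\<close>

subsection \<open>Symmetrization and contraction\<close>

text \<open>With \<open>a\<close> the larger of \<open>a\<close> and \<open>b\<close>, expanding
  \<open>0 <= (a - x) * (a - y)\<close> gives \<open>a * (x + y) <= a * (a + b)\<close>. The
  contraction lemma uses this to compare two pairs of exponentials through their products and maxima
  only.\<close>

lemma add_le_add_if_majorized:
  fixes x y a b :: real
  assumes "0 \<le> x" "0 \<le> y" "0 \<le> a" "0 \<le> b"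
    and prod: "x * y \<le> a * b" and max: "max x y \<le> max a b"
  shows "x + y \<le> a + b"
proof -
  have *: "x + y \<le> a + b"
    if "0 \<le> x" "0 \<le> y" "0 \<le> b" "x * y \<le> a * b" "x \<le> a" "y \<le> a" for x y a b :: real
  proof (cases "a = 0")
    case False
    then have "0 < a" using that by linarith
    have "0 \<le> (a - x) * (a - y)" using that by simp
    then have "a * (x + y) \<le> a * (a + b)" using that(4) by (simp add: algebra_simps)
    then show ?thesis using \<open>0 < a\<close> by simp
  qed (use that in auto)
  show ?thesis
  proof (cases "b \<le> a")
    case True
    then show ?thesis using *[of x y b a] assms by auto
  next
    case False
    then show ?thesis using *[of x y a b] assms by (auto simp: mult.commute)
  qed
qed

text \<open>The contraction principle for a single sign. The left side is a supremum over pairs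
  \<open>b\<close>, \<open>c\<close>. For each pair the Lipschitz hypothesis bounds the product of
  the two exponentials and the domination hypothesis bounds their maximum, and these two bounds
  control the sum.\<close>

lemma SUP_exp_contraction:
  fixes a \<phi> u :: "'b \<Rightarrow> real"
  assumes le: "\<And>b. b \<in> D \<Longrightarrow> \<bar>\<phi> b\<bar> \<le> \<bar>u b\<bar>"
    and lip: "\<And>b c. b \<in> D \<Longrightarrow> c \<in> D \<Longrightarrow> \<bar>\<phi> b - \<phi> c\<bar> \<le> \<bar>u b - u c\<bar>"
  shows "(SUP b\<in>D. ennreal (exp (a b + \<phi> b))) + (SUP b\<in>D. ennreal (exp (a b - \<phi> b)))
    \<le> (SUP b\<in>D. ennreal (exp (a b + u b))) + (SUP b\<in>D. ennreal (exp (a b - u b)))"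
    (is "_ \<le> ?P + ?Q")
proof (cases "D = {} \<or> ?P = \<top> \<or> ?Q = \<top>")
  case True
  then consider "D = {}" | "?P = \<top>" | "?Q = \<top>" by blast
  then show ?thesis by cases (simp, simp_all only: add_top_right_ennreal add_top_left_ennreal top_greatest)
next
  case False
  then obtain p q where p: "?P = ennreal p" "0 \<le> p" and q: "?Q = ennreal q" "0 \<le> q"
    by (cases ?P; cases ?Q) auto
  have pb: "exp (a b + u b) \<le> p" if "b \<in> D" for b
    using SUP_upper[OF that, of "\<lambda>b. ennreal (exp (a b + u b))"] p by (simp add: ennreal_le_iff)
  have qb: "exp (a b - u b) \<le> q" if "b \<in> D" for b
    using SUP_upper[OF that, of "\<lambda>b. ennreal (exp (a b - u b))"] q by (simp add: ennreal_le_iff)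
  have "ennreal (exp (a b + \<phi> b)) + ennreal (exp (a c - \<phi> c)) \<le> ?P + ?Q"
    if "b \<in> D" "c \<in> D" for b c
  proof -
    have le_max: "exp (a d + \<bar>u d\<bar>) \<le> max p q" if "d \<in> D" for d
      using pb[OF that] qb[OF that] by (cases "u d \<ge> 0") (auto simp: le_max_iff_disj)
    have "exp (a b + \<phi> b) \<le> exp (a b + \<bar>u b\<bar>)" "exp (a c - \<phi> c) \<le> exp (a c + \<bar>u c\<bar>)"
      using le[OF that(1)] le[OF that(2)] by auto
    then have 1: "max (exp (a b + \<phi> b)) (exp (a c - \<phi> c)) \<le> max p q"
      using le_max[OF that(1)] le_max[OF that(2)] by linarith
    have "exp (a b + \<phi> b) * exp (a c - \<phi> c) \<le> exp (a b + a c + \<bar>u b - u c\<bar>)"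
      using lip[OF that] by (simp add: exp_add[symmetric])
    \<comment> \<open>Whichever of \<open>b\<close>, \<open>c\<close> has the larger
      \<open>u\<close> is inserted in the first supremum and the other one in the second; this
      resolves the absolute value.\<close>
    also have "\<dots> \<le> p * q"
    proof (cases "u c \<le> u b")
      case True
      have "exp (a b + u b) * exp (a c - u c) \<le> p * q"
        using pb[OF that(1)] qb[OF that(2)] p q by (intro mult_mono) auto
      then show ?thesis using True by (simp add: exp_add[symmetric] algebra_simps)
    next
      case False
      have "exp (a c + u c) * exp (a b - u b) \<le> p * q"
        using pb[OF that(2)] qb[OF that(1)] p q by (intro mult_mono) auto
      then show ?thesis using False by (simp add: exp_add[symmetric] algebra_simps)
    qed
    finally have "exp (a b + \<phi> b) + exp (a c - \<phi> c) \<le> p + q"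
      using 1 p q by (intro add_le_add_if_majorized) auto
    then show ?thesis using p q by (simp flip: ennreal_plus)
  qed
  then have "(SUP b\<in>D. SUP c\<in>D. ennreal (exp (a b + \<phi> b)) + ennreal (exp (a c - \<phi> c))) \<le> ?P + ?Q"
    by (intro SUP_least)
  \<comment> \<open>A constant summand can be moved out of a supremum only over a nonempty set,
    since the empty supremum is 0.\<close>
  moreover have "D \<noteq> {}" using False by simp
  ultimately show ?thesis
    by (simp only: ennreal_SUP_add_left ennreal_SUP_add_right[symmetric] not_False_eq_True)
qed

text \<open>Jensen's inequality if \<open>exp (F x)\<close> is integrable; otherwise the right side
  is infinite. The extended integral thus covers functions without exponential moments.\<close>

lemma (in prob_space) exp_expectation_le_nn_integral:
  fixes F :: "'a \<Rightarrow> real"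
  assumes F: "integrable M F"
  shows "ennreal (exp (expectation F)) \<le> (\<integral>\<^sup>+x. ennreal (exp (F x)) \<partial>M)"
proof (cases "integrable M (\<lambda>x. exp (F x))")
  case True
  have "exp (expectation F) \<le> expectation (\<lambda>x. exp (F x))"
    using jensens_inequality[where X = F and I = UNIV and q = exp] F True by (simp add: exp_convex)
  also have "ennreal \<dots> = (\<integral>\<^sup>+x. ennreal (exp (F x)) \<partial>M)"
    using True by (simp add: nn_integral_eq_integral)
  finally show ?thesis by (simp add: ennreal_leI)
next
  case False
  then have "(\<integral>\<^sup>+x. ennreal (exp (F x)) \<partial>M) = \<infinity>"
    using F by (auto simp: integrable_iff_bounded less_top[symmetric])
  then show ?thesis by simp
qed

text \<open>Bounding \<open>exp (F z' - F z)\<close> by the mean of \<open>exp (2 F z')\<close> and \<open>exp (- 2 F z)\<close>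
  makes an exchange argument with Rademacher signs unnecessary.\<close>

lemma (in prob_space) symmetrization_exp:
  fixes F :: "'b \<Rightarrow> 'a \<Rightarrow> real" and a :: "'b \<Rightarrow> real"
  assumes D: "countable D" and F: "\<And>b. b \<in> D \<Longrightarrow> integrable M (F b)"
  shows "2 * (\<integral>\<^sup>+z. (SUP b\<in>D. ennreal (exp (a b + (expectation (F b) - F b z)))) \<partial>M)
    \<le> (\<integral>\<^sup>+z. (SUP b\<in>D. ennreal (exp (a b + 2 * F b z))) \<partial>M)
      + (\<integral>\<^sup>+z. (SUP b\<in>D. ennreal (exp (a b - 2 * F b z))) \<partial>M)"
proof -
  let ?P = "\<lambda>z. SUP b\<in>D. ennreal (exp (a b + 2 * F b z))"
  let ?Q = "\<lambda>z. SUP b\<in>D. ennreal (exp (a b - 2 * F b z))"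
  note [measurable] = borel_measurable_integrable[OF F]
  have [measurable]: "?P \<in> borel_measurable M" "?Q \<in> borel_measurable M"
    using D by (auto intro!: borel_measurable_SUP)
  have pt: "2 * ennreal (exp (a b + (expectation (F b) - F b z))) \<le> (\<integral>\<^sup>+z'. ?P z' \<partial>M) + ?Q z"
    if b: "b \<in> D" for b z
  proof -
    have [measurable]: "F b \<in> borel_measurable M" using F[OF b] by simp
    have *: "2 * exp (a b + (F b z' - F b z)) \<le> exp (a b + 2 * F b z') + exp (a b - 2 * F b z)" for z'
    proof -
      have "0 \<le> (exp ((a b + 2 * F b z') / 2) - exp ((a b - 2 * F b z) / 2))\<^sup>2" by simp
      then show ?thesis
        by (simp add: power2_diff exp_double[symmetric] exp_add[symmetric] mult.assoc add_divide_distrib diff_divide_distrib)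
    qed
    \<comment> \<open>The mean is written as an average over a second point \<open>z'\<close>, so
      that Jensen's inequality moves the exponential under the integral.\<close>
    have "exp (a b + (expectation (F b) - F b z)) = exp (expectation (\<lambda>z'. a b + (F b z' - F b z)))"
      using F[OF b] by (simp add: prob_space)
    also have "ennreal \<dots> \<le> (\<integral>\<^sup>+z'. ennreal (exp (a b + (F b z' - F b z))) \<partial>M)"
      using F[OF b] by (intro exp_expectation_le_nn_integral) auto
    finally have "2 * ennreal (exp (a b + (expectation (F b) - F b z)))
        \<le> 2 * (\<integral>\<^sup>+z'. ennreal (exp (a b + (F b z' - F b z))) \<partial>M)"
      by (intro mult_left_mono) auto
    also have "\<dots> = (\<integral>\<^sup>+z'. ennreal (2 * exp (a b + (F b z' - F b z))) \<partial>M)"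
      by (simp add: nn_integral_cmult ennreal_mult)
    also have "\<dots> \<le> (\<integral>\<^sup>+z'. ?P z' + ?Q z \<partial>M)"
    proof (intro nn_integral_mono)
      fix z'
      have "ennreal (2 * exp (a b + (F b z' - F b z)))
          \<le> ennreal (exp (a b + 2 * F b z')) + ennreal (exp (a b - 2 * F b z))"
        using *[of z'] by (simp flip: ennreal_plus add: ennreal_leI)
      also have "\<dots> \<le> ?P z' + ?Q z"
        using b by (intro add_mono SUP_upper)
      finally show "ennreal (2 * exp (a b + (F b z' - F b z))) \<le> ?P z' + ?Q z" .
    qed
    also have "\<dots> = (\<integral>\<^sup>+z'. ?P z' \<partial>M) + ?Q z"
      by (simp add: nn_integral_add emeasure_space_1)
    finally show ?thesis .
  qed
  have "2 * (\<integral>\<^sup>+z. (SUP b\<in>D. ennreal (exp (a b + (expectation (F b) - F b z)))) \<partial>M)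
      = (\<integral>\<^sup>+z. (SUP b\<in>D. 2 * ennreal (exp (a b + (expectation (F b) - F b z)))) \<partial>M)"
    using D by (subst nn_integral_cmult[symmetric]) (auto intro!: borel_measurable_SUP simp: SUP_mult_left_ennreal)
  also have "\<dots> \<le> (\<integral>\<^sup>+z. (\<integral>\<^sup>+z'. ?P z' \<partial>M) + ?Q z \<partial>M)"
    by (intro nn_integral_mono SUP_least pt)
  also have "\<dots> = (\<integral>\<^sup>+z. ?P z \<partial>M) + (\<integral>\<^sup>+z. ?Q z \<partial>M)"
    by (simp add: nn_integral_add emeasure_space_1)
  finally show ?thesis .
qed

subsection \<open>Exponential moments of the sup-deviation\<close>

lemma inner_le_l1_norm_mult:
  fixes \<Delta> v :: "real ^ 'p::finite"
  assumes "\<And>j. \<bar>v $ j\<bar> \<le> m"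
  shows "\<bar>\<Delta> \<bullet> v\<bar> \<le> l1_norm \<Delta> * m"
proof -
  have "\<bar>\<Delta> \<bullet> v\<bar> \<le> (\<Sum>j\<in>UNIV. \<bar>\<Delta> $ j\<bar> * \<bar>v $ j\<bar>)"
    unfolding inner_vec_def by (rule order_trans[OF sum_abs]) (simp add: abs_mult)
  also have "\<dots> \<le> (\<Sum>j\<in>UNIV. \<bar>\<Delta> $ j\<bar> * m)"
    using assms by (intro sum_mono mult_left_mono) auto
  finally show ?thesis by (simp add: l1_norm_on_def sum_distrib_right)
qed

text \<open>On the l1-ball a linear functional is largest at a vertex, that is, at a signed unit
  vector scaled by \<open>r\<close>. Replacing the maximum over vertices by the sum produces the
  factor of twice the dimension in the final tail.\<close>

lemma exp_inner_le:
  fixes \<Delta> v :: "real ^ 'p::finite"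
  assumes "\<Delta> \<in> l1_ball r" "0 \<le> r" "0 \<le> K"
  shows "exp (K * (\<Delta> \<bullet> v)) \<le> (\<Sum>j\<in>UNIV. exp (K * r * v $ j) + exp (- (K * r * v $ j)))"
proof -
  have fin: "finite (range (\<lambda>j. \<bar>v $ j\<bar>))" by simp
  obtain k where k: "Max (range (\<lambda>j. \<bar>v $ j\<bar>)) = \<bar>v $ k\<bar>"
    using Max_in[OF fin] by (metis (no_types, lifting) UNIV_not_empty image_iff image_is_empty)
  have "\<Delta> \<bullet> v \<le> l1_norm \<Delta> * \<bar>v $ k\<bar>"
    using inner_le_l1_norm_mult[of v "\<bar>v $ k\<bar>" \<Delta>] k Max_ge[OF fin] by fastforce
  also have "\<dots> \<le> r * \<bar>v $ k\<bar>"
    using assms(1) by (intro mult_right_mono) (auto simp: l1_ball_def)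
  finally have "K * (\<Delta> \<bullet> v) \<le> K * (r * \<bar>v $ k\<bar>)"
    using \<open>0 \<le> K\<close> by (rule mult_left_mono)
  then have "exp (K * (\<Delta> \<bullet> v)) \<le> exp (K * r * \<bar>v $ k\<bar>)" by (simp add: mult.assoc)
  also have "\<dots> \<le> exp (K * r * v $ k) + exp (- (K * r * v $ k))"
    by (cases "0 \<le> v $ k") auto
  also have "\<dots> \<le> (\<Sum>j\<in>UNIV. exp (K * r * v $ j) + exp (- (K * r * v $ j)))"
    by (rule member_le_sum) (auto intro: add_nonneg_nonneg)
  finally show ?thesis .
qed

lemma subgaussian_nn_integral_le:
  assumes "subgaussian N v Z"
  shows "(\<integral>\<^sup>+z. ennreal (exp (t * Z z)) \<partial>N) \<le> ennreal (exp (t\<^sup>2 * v / 2))"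
  using assms by (auto simp: subgaussian_def nn_integral_eq_integral intro!: ennreal_leI)

text \<open>Each exponential factors into a \<open>y\<close> part and a \<open>Z\<close> part, and
  the moment bound depends on \<open>t\<close> only through its square, so both signs cost the same
  factor. The shape in \<open>y\<close> is preserved, which allows iteration over the
  observations.\<close>

lemma subgaussian_cosh:
  assumes Z: "subgaussian N v Z" and v: "v \<le> w"
  shows "(\<integral>\<^sup>+z. ennreal (exp (t * (y + Z z)) + exp (- (t * (y + Z z)))) \<partial>N)
    \<le> ennreal ((exp (t * y) + exp (- (t * y))) * exp (t\<^sup>2 * w / 2))"
proof -
  have meas[measurable]: "(\<lambda>z. exp (s * Z z)) \<in> borel_measurable N" for s
    using Z by (auto simp: subgaussian_def)
  have le: "(\<integral>\<^sup>+z. ennreal (exp (s * Z z)) \<partial>N) \<le> ennreal (exp (t\<^sup>2 * w / 2))" if "s\<^sup>2 = t\<^sup>2" for s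
    using subgaussian_nn_integral_le[OF Z, of s] that v
    by (elim order_trans) (auto intro!: ennreal_leI mult_left_mono)
  have "(\<integral>\<^sup>+z. ennreal (exp (t * (y + Z z)) + exp (- (t * (y + Z z)))) \<partial>N)
      = (\<integral>\<^sup>+z. ennreal (exp (t * y)) * ennreal (exp (t * Z z))
          + ennreal (exp (- (t * y))) * ennreal (exp (- t * Z z)) \<partial>N)"
    by (intro nn_integral_cong)
      (simp add: distrib_left exp_add[symmetric] exp_diff[symmetric] flip: ennreal_mult ennreal_plus)
  also have "\<dots> = ennreal (exp (t * y)) * (\<integral>\<^sup>+z. ennreal (exp (t * Z z)) \<partial>N)
      + ennreal (exp (- (t * y))) * (\<integral>\<^sup>+z. ennreal (exp (- t * Z z)) \<partial>N)"
    using meas[of t] meas[of "- t"] by (subst nn_integral_add) (auto simp: nn_integral_cmult)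
  also have "\<dots> \<le> ennreal (exp (t * y)) * ennreal (exp (t\<^sup>2 * w / 2))
      + ennreal (exp (- (t * y))) * ennreal (exp (t\<^sup>2 * w / 2))"
    by (intro add_mono mult_left_mono le) auto
  also have "\<dots> = ennreal ((exp (t * y) + exp (- (t * y))) * exp (t\<^sup>2 * w / 2))"
    by (simp add: distrib_right flip: ennreal_mult ennreal_plus)
  finally show ?thesis .
qed

text \<open>Induction over the observations with \<open>y\<close> arbitrary: \<open>y\<close>
  collects the signed values of \<open>x\<close> at the observations already treated. A step
  symmetrizes and contracts one observation, uses the induction hypothesis at \<open>y + x u\<close>
  and \<open>y - x u\<close>, and pays one factor \<open>exp ((K * r)\<^sup>2 * w / 2)\<close>. The
  2 in front of \<open>F\<close> in the hypotheses is the doubling caused by symmetrization.\<close>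

lemma exp_sup_deviation_le:
  fixes N :: "'z measure" and x :: "'z \<Rightarrow> real ^ 'p::finite" and F :: "real ^ 'p \<Rightarrow> 'z \<Rightarrow> real"
    and I :: "'i set"
  assumes N: "prob_space N"
    and D: "countable D" "D \<subseteq> l1_ball r" and r: "0 \<le> r" and K: "0 \<le> K"
    and x[measurable]: "x \<in> borel_measurable N"
    and F: "\<And>b. b \<in> D \<Longrightarrow> integrable N (F b)"
    and F_le: "\<And>b z. b \<in> D \<Longrightarrow> z \<in> space N \<Longrightarrow> \<bar>2 * F b z\<bar> \<le> \<bar>K * (b \<bullet> x z)\<bar>"
    and F_lip: "\<And>b c z. b \<in> D \<Longrightarrow> c \<in> D \<Longrightarrow> z \<in> space N \<Longrightarrow>
      \<bar>2 * F b z - 2 * F c z\<bar> \<le> \<bar>K * (b \<bullet> x z) - K * (c \<bullet> x z)\<bar>"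
    and subg: "\<And>j. subgaussian N (v j) (\<lambda>z. x z $ j)" "\<And>j. v j \<le> w"
    and I: "finite I"
  shows "(\<integral>\<^sup>+z. (SUP b\<in>D. ennreal (exp (K * (b \<bullet> y)
        + (\<Sum>i\<in>I. (\<integral>u. F b u \<partial>N) - F b (z i))))) \<partial>(\<Pi>\<^sub>M i\<in>I. N))
    \<le> ennreal ((\<Sum>j\<in>UNIV. exp (K * r * y $ j) + exp (- (K * r * y $ j)))
        * exp (real (card I) * ((K * r)\<^sup>2 * w / 2)))"
  using I
proof (induction I arbitrary: y)
  case empty
  interpret product_sigma_finite "\<lambda>_. N"
    by (intro product_sigma_finite.intro prob_space_imp_sigma_finite N)
  show ?case using D r K
    by (auto simp: nn_integral_empty PiM_empty nn_integral_count_space_finite intro!: SUP_least ennreal_leI exp_inner_le)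
next
  case (insert i I)
  interpret N: prob_space N by fact
  interpret S: product_sigma_finite "\<lambda>_. N" by standard
  interpret SI: sigma_finite_measure "\<Pi>\<^sub>M i\<in>I. N" using insert S.sigma_finite by auto
  interpret P: pair_sigma_finite N "\<Pi>\<^sub>M i\<in>I. N" ..
  note [measurable] = borel_measurable_integrable[OF F]
  have [measurable]: "(\<lambda>u. x u $ j) \<in> borel_measurable N" for j
    by (rule borel_measurable_continuous_on[OF _ x]) (intro continuous_intros)
  define E where "E b z = (\<Sum>i\<in>I. (\<integral>u. F b u \<partial>N) - F b (z i))" for b and z :: "'i \<Rightarrow> 'z"
  define c where "c = (K * r)\<^sup>2 * w / 2"
  have E_meas[measurable]: "E b \<in> borel_measurable (\<Pi>\<^sub>M i\<in>I. N)" if "b \<in> D" for b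
    using that unfolding E_def by measurable
  \<comment> \<open>For fixed other observations \<open>z\<close>, their contribution
    \<open>E b z\<close> is part of the offset that symmetrization and contraction leave
    untouched.\<close>
  have *: "(\<integral>\<^sup>+u. (SUP b\<in>D. ennreal (exp (K * (b \<bullet> y) + (\<Sum>k\<in>insert i I. (\<integral>u. F b u \<partial>N) - F b ((z(i := u)) k))))) \<partial>N)
    \<le> (\<integral>\<^sup>+u. ennreal (1/2) * ((SUP b\<in>D. ennreal (exp (K * (b \<bullet> (y + x u)) + E b z)))
         + (SUP b\<in>D. ennreal (exp (K * (b \<bullet> (y - x u)) + E b z)))) \<partial>N)"
    if z: "z \<in> space (\<Pi>\<^sub>M i\<in>I. N)" for z
  proof -
    let ?a = "\<lambda>b. K * (b \<bullet> y) + E b z"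
    let ?L = "\<integral>\<^sup>+u. (SUP b\<in>D. ennreal (exp (?a b + ((\<integral>u. F b u \<partial>N) - F b u)))) \<partial>N"
    have "2 * ?L \<le> (\<integral>\<^sup>+u. (SUP b\<in>D. ennreal (exp (?a b + 2 * F b u))) \<partial>N)
        + (\<integral>\<^sup>+u. (SUP b\<in>D. ennreal (exp (?a b - 2 * F b u))) \<partial>N)"
      by (intro N.symmetrization_exp D F)
    also have "\<dots> = (\<integral>\<^sup>+u. (SUP b\<in>D. ennreal (exp (?a b + 2 * F b u)))
        + (SUP b\<in>D. ennreal (exp (?a b - 2 * F b u))) \<partial>N)"
      using D by (intro nn_integral_add[symmetric] borel_measurable_SUP) auto
    also have "\<dots> \<le> (\<integral>\<^sup>+u. (SUP b\<in>D. ennreal (exp (?a b + K * (b \<bullet> x u))))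
        + (SUP b\<in>D. ennreal (exp (?a b - K * (b \<bullet> x u)))) \<partial>N)"
      by (intro nn_integral_mono SUP_exp_contraction F_le F_lip)
    finally have "ennreal (1/2) * (2 * ?L) \<le> ennreal (1/2) * (\<integral>\<^sup>+u. (SUP b\<in>D. ennreal (exp (?a b + K * (b \<bullet> x u))))
        + (SUP b\<in>D. ennreal (exp (?a b - K * (b \<bullet> x u)))) \<partial>N)"
      by (intro mult_left_mono) auto
    moreover have "ennreal (1/2) * (2 * ?L) = ?L"
      using ennreal_mult[of "1/2" 2] by (simp add: mult.assoc[symmetric])
    moreover have "(\<integral>\<^sup>+u. (SUP b\<in>D. ennreal (exp (K * (b \<bullet> y) + (\<Sum>k\<in>insert i I. (\<integral>u. F b u \<partial>N) - F b ((z(i := u)) k))))) \<partial>N) = ?L"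
      using insert by (auto simp: E_def algebra_simps intro!: nn_integral_cong SUP_cong sum.cong)
    ultimately show ?thesis
      using D by (subst nn_integral_cmult) (auto simp: inner_right_distrib inner_diff_right algebra_simps intro!: borel_measurable_SUP)
  qed
  let ?C = "\<lambda>y. \<Sum>j\<in>UNIV. exp (K * r * y $ j) + exp (- (K * r * y $ j))"
  have [measurable]: "(\<lambda>(z, u). SUP b\<in>D. ennreal (exp (K * (b \<bullet> (y + x u)) + E b z))) \<in> borel_measurable ((\<Pi>\<^sub>M i\<in>I. N) \<Otimes>\<^sub>M N)"
    "(\<lambda>(z, u). SUP b\<in>D. ennreal (exp (K * (b \<bullet> (y - x u)) + E b z))) \<in> borel_measurable ((\<Pi>\<^sub>M i\<in>I. N) \<Otimes>\<^sub>M N)"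
    unfolding split_beta using D by (auto intro!: borel_measurable_SUP)
  \<comment> \<open>The signs \<open>s = 1\<close> and \<open>s = -1\<close> are treated together:
    passing from \<open>t\<close> to \<open>t * s\<close> does not change the square in the
    subgaussian bound.\<close>
  have sub: "(\<integral>\<^sup>+u. ennreal (?C (y + s *\<^sub>R x u)) \<partial>N) \<le> ennreal (?C y * exp c)" if s: "s\<^sup>2 = 1" for s
  proof -
    have "(\<integral>\<^sup>+u. ennreal (?C (y + s *\<^sub>R x u)) \<partial>N)
      = (\<Sum>j\<in>UNIV. \<integral>\<^sup>+u. ennreal (exp (K * r * (y $ j + s * x u $ j)) + exp (- (K * r * (y $ j + s * x u $ j)))) \<partial>N)"
      by (subst nn_integral_sum[symmetric]) (auto simp: sum_ennreal add_nonneg_nonneg simp del: ennreal_plus)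
    also have "\<dots> \<le> (\<Sum>j\<in>UNIV. ennreal ((exp (K * r * y $ j) + exp (- (K * r * y $ j))) * exp c))"
    proof (intro sum_mono)
      fix j :: 'p
      have "subgaussian N (v j) (\<lambda>u. s * x u $ j)"
        unfolding subgaussian_def
      proof
        fix t
        show "integrable N (\<lambda>u. exp (t * (s * x u $ j))) \<and> (\<integral>u. exp (t * (s * x u $ j)) \<partial>N) \<le> exp (t\<^sup>2 * v j / 2)"
          using subg(1)[of j, unfolded subgaussian_def, rule_format, of "t * s"] s
          by (simp add: power_mult_distrib mult.assoc)
      qed
      then show "(\<integral>\<^sup>+u. ennreal (exp (K * r * (y $ j + s * x u $ j)) + exp (- (K * r * (y $ j + s * x u $ j)))) \<partial>N)
        \<le> ennreal ((exp (K * r * y $ j) + exp (- (K * r * y $ j))) * exp c)"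
        unfolding c_def by (rule subgaussian_cosh) (rule subg)
    qed
    also have "\<dots> = ennreal (?C y * exp c)"
      by (simp add: sum_ennreal add_nonneg_nonneg sum_distrib_right)
    finally show ?thesis .
  qed
  have scale: "ennreal h * (ennreal (A * e) + ennreal (B * e)) = ennreal (h * e) * (ennreal A + ennreal B)"
    if "0 \<le> h" "0 \<le> A" "0 \<le> B" "0 \<le> e" for h A B e :: real
    using that by (simp add: algebra_simps flip: ennreal_mult ennreal_plus)
  have C_nonneg: "0 \<le> ?C y" for y by (intro sum_nonneg add_nonneg_nonneg) auto
  have "(\<integral>\<^sup>+z. (SUP b\<in>D. ennreal (exp (K * (b \<bullet> y)
        + (\<Sum>i\<in>insert i I. (\<integral>u. F b u \<partial>N) - F b (z i))))) \<partial>(\<Pi>\<^sub>M i\<in>insert i I. N))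
     = (\<integral>\<^sup>+z. (\<integral>\<^sup>+u. (SUP b\<in>D. ennreal (exp (K * (b \<bullet> y) + (\<Sum>k\<in>insert i I. (\<integral>u. F b u \<partial>N) - F b ((z(i := u)) k))))) \<partial>N) \<partial>(\<Pi>\<^sub>M i\<in>I. N))"
    using insert D by (intro S.product_nn_integral_insert borel_measurable_SUP) auto
  also have "\<dots> \<le> (\<integral>\<^sup>+z. (\<integral>\<^sup>+u. ennreal (1/2) * ((SUP b\<in>D. ennreal (exp (K * (b \<bullet> (y + x u)) + E b z)))
         + (SUP b\<in>D. ennreal (exp (K * (b \<bullet> (y - x u)) + E b z)))) \<partial>N) \<partial>(\<Pi>\<^sub>M i\<in>I. N))"
    by (intro nn_integral_mono *)
  \<comment> \<open>After exchanging the integrals \<open>u\<close> is fixed, so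
    \<open>y + x u\<close> and \<open>y - x u\<close> are constants at which the induction
    hypothesis can be used.\<close>
  also have "\<dots> = (\<integral>\<^sup>+u. (\<integral>\<^sup>+z. ennreal (1/2) * ((SUP b\<in>D. ennreal (exp (K * (b \<bullet> (y + x u)) + E b z)))
         + (SUP b\<in>D. ennreal (exp (K * (b \<bullet> (y - x u)) + E b z)))) \<partial>(\<Pi>\<^sub>M i\<in>I. N)) \<partial>N)"
    by (intro P.Fubini') measurable
  also have "\<dots> = (\<integral>\<^sup>+u. ennreal (1/2) * ((\<integral>\<^sup>+z. (SUP b\<in>D. ennreal (exp (K * (b \<bullet> (y + x u)) + E b z))) \<partial>(\<Pi>\<^sub>M i\<in>I. N))
         + (\<integral>\<^sup>+z. (SUP b\<in>D. ennreal (exp (K * (b \<bullet> (y - x u)) + E b z))) \<partial>(\<Pi>\<^sub>M i\<in>I. N))) \<partial>N)"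
    using D by (intro nn_integral_cong) (simp add: nn_integral_cmult nn_integral_add borel_measurable_SUP)
  also have "\<dots> \<le> (\<integral>\<^sup>+u. ennreal (1/2) * (ennreal (?C (y + x u) * exp (real (card I) * c))
         + ennreal (?C (y - x u) * exp (real (card I) * c))) \<partial>N)"
    unfolding E_def c_def by (intro nn_integral_mono mult_left_mono add_mono insert.IH) simp
  also have "\<dots> = (\<integral>\<^sup>+u. ennreal (exp (real (card I) * c) / 2) * (ennreal (?C (y + 1 *\<^sub>R x u)) + ennreal (?C (y + (-1) *\<^sub>R x u))) \<partial>N)"
  proof (intro nn_integral_cong)
    fix u
    show "ennreal (1/2) * (ennreal (?C (y + x u) * exp (real (card I) * c)) + ennreal (?C (y - x u) * exp (real (card I) * c)))
      = ennreal (exp (real (card I) * c) / 2) * (ennreal (?C (y + 1 *\<^sub>R x u)) + ennreal (?C (y + (-1) *\<^sub>R x u)))"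
      using scale[of "1/2" "?C (y + x u)" "?C (y - x u)" "exp (real (card I) * c)"] C_nonneg[of "y + x u"] C_nonneg[of "y - x u"]
      by (simp del: ennreal_plus)
  qed
  also have "\<dots> = ennreal (exp (real (card I) * c) / 2) * ((\<integral>\<^sup>+u. ennreal (?C (y + 1 *\<^sub>R x u)) \<partial>N) + (\<integral>\<^sup>+u. ennreal (?C (y + (-1) *\<^sub>R x u)) \<partial>N))"
    by (simp add: nn_integral_cmult nn_integral_add)
  also have "\<dots> \<le> ennreal (exp (real (card I) * c) / 2) * (ennreal (?C y * exp c) + ennreal (?C y * exp c))"
    by (intro mult_left_mono add_mono sub) auto
  also have "\<dots> = ennreal (?C y * exp (real (card (insert i I)) * c))"
    using insert C_nonneg[of y]
    by (simp add: distrib_right distrib_left exp_add mult_ac flip: ennreal_mult ennreal_plus)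
  finally show ?case by (simp add: c_def)
qed

section \<open>Tail of the sup-deviation for an iid sample\<close>

lemma subgaussian_distr_iff:
  assumes [measurable]: "Z \<in> measurable M N" "g \<in> borel_measurable N"
  shows "subgaussian (distr M N Z) v g \<longleftrightarrow> subgaussian M v (\<lambda>\<omega>. g (Z \<omega>))"
  by (simp add: subgaussian_def integrable_distr_eq integral_distr)

text \<open>The exponential moments at 1 and -1 suffice, because
  \<open>|z| <= exp z + exp (- z)\<close>.\<close>

lemma subgaussian_integrable:
  assumes "subgaussian M v Z" and [measurable]: "Z \<in> borel_measurable M"
  shows "integrable M Z"
proof (rule Bochner_Integration.integrable_bound)
  show "integrable M (\<lambda>\<omega>. exp (1 * Z \<omega>) + exp (- 1 * Z \<omega>))"
    using assms(1) unfolding subgaussian_def by (intro Bochner_Integration.integrable_add) blast+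
  have "\<bar>z\<bar> \<le> exp z + exp (- z)" for z :: real
    using exp_ge_add_one_self[of z] exp_ge_add_one_self[of "- z"] exp_gt_zero[of z] exp_gt_zero[of "- z"]
    by linarith
  then show "AE \<omega> in M. norm (Z \<omega>) \<le> norm (exp (1 * Z \<omega>) + exp (- 1 * Z \<omega>))"
    by (auto simp: abs_of_nonneg add_nonneg_nonneg)
qed simp

text \<open>Chernoff's method: Markov's inequality is applied to the exponential moment of the
  supremum. Countability of \<open>D\<close> makes both \<open>A\<close> and this supremum
  measurable.\<close>

lemma sup_deviation_tail:
  fixes M :: "'a measure" and N :: "'b measure" and x :: "'b \<Rightarrow> real ^ 'p::finite"
    and f :: "real ^ 'p \<Rightarrow> 'b \<Rightarrow> real"
  assumes M: "prob_space M" and n: "1 \<le> n" and iid: "iid_copies M N Z n Zs"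
    and D: "countable D" "D \<subseteq> l1_ball r" and pos: "0 < r" "0 < L" "0 < w" "0 < q"
    and x[measurable]: "x \<in> borel_measurable N"
    and f[measurable]: "\<And>b. b \<in> D \<Longrightarrow> f b \<in> borel_measurable N"
    and int: "\<And>b. b \<in> D \<Longrightarrow> integrable M (\<lambda>\<omega>. f b (Z \<omega>))"
    and f_le: "\<And>b z. b \<in> D \<Longrightarrow> z \<in> space N \<Longrightarrow> \<bar>f b z\<bar> \<le> L * \<bar>b \<bullet> x z\<bar>"
    and f_lip: "\<And>b c z. b \<in> D \<Longrightarrow> c \<in> D \<Longrightarrow> z \<in> space N \<Longrightarrow>
      \<bar>f b z - f c z\<bar> \<le> L * \<bar>b \<bullet> x z - c \<bullet> x z\<bar>"
    and subg: "\<And>j. subgaussian M (v j) (\<lambda>\<omega>. x (Z \<omega>) $ j)" "\<And>j. v j \<le> w"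
  defines "A \<equiv> {\<omega>\<in>space M. \<exists>b\<in>D. real n * (q * r) \<le> (\<Sum>i=1..n. (\<integral>\<omega>. f b (Z \<omega>) \<partial>M) - f b (Zs i \<omega>))}"
  shows "A \<in> sets M"
    and "measure M A \<le> 2 * real CARD('p) * exp (- (real n * q\<^sup>2 / (8 * L\<^sup>2 * w)))"
proof -
  interpret prob_space M by fact
  have Z[measurable]: "Z \<in> measurable M N"
    and ind: "indep_vars (\<lambda>_. N) Zs {1..n}"
    and eq: "\<And>i. i \<in> {1..n} \<Longrightarrow> distr M N (Zs i) = distr M N Z"
    using iid by (auto simp: iid_copies_def)
  have Zs[measurable]: "Zs i \<in> measurable M N" if "i \<in> {1..n}" for i
    using ind that by (auto simp: indep_vars_def)
  have [measurable]: "(\<lambda>\<omega>. f b (Zs i \<omega>)) \<in> borel_measurable M" if "b \<in> D" "i \<in> {1..n}" for b i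
    using measurable_compose[OF Zs[OF that(2)] f[OF that(1)]] .
  have [measurable]: "(\<lambda>z. x z $ j) \<in> borel_measurable N" for j
    by (rule borel_measurable_continuous_on[OF _ x]) (intro continuous_intros)
  have "A = (\<Union>b\<in>D. {\<omega>\<in>space M. real n * (q * r) \<le> (\<Sum>i=1..n. (\<integral>\<omega>. f b (Z \<omega>) \<partial>M) - f b (Zs i \<omega>))})"
    by (auto simp: A_def)
  also have "\<dots> \<in> sets M"
    using D(1) by (intro sets.countable_UN'') auto
  finally show A: "A \<in> sets M" .

  define N' where "N' = distr M N Z"
  have sets_N'[measurable_cong]: "sets N' = sets N" and space_N': "space N' = space N"
    by (simp_all add: N'_def)
  have N': "prob_space N'" unfolding N'_def by (rule prob_space_distr) fact
  \<comment> \<open>This \<open>s\<close> minimizes the exponent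
    \<open>n * ((2 * s * L * r)\<^sup>2 * w / 2) - n * (s * q * r)\<close>; the minimum is the
    exponent in the claim.\<close>
  define s where "s = q / (4 * L\<^sup>2 * r * w)"
  have s: "0 < s" using pos by (simp add: s_def)
  define F where "F b z = s * f b z" for b z
  \<comment> \<open>The linear part starts at \<open>y = 0\<close>, where every summand of the
    moment bound equals 2.\<close>
  define h where "h z = (SUP b\<in>D. ennreal (exp (2 * s * L * (b \<bullet> 0)
      + (\<Sum>i\<in>{1..n}. (\<integral>u. F b u \<partial>N') - F b (z i)))))" for z :: "nat \<Rightarrow> 'b"
  have F_int: "(\<integral>u. F b u \<partial>N') = s * (\<integral>\<omega>. f b (Z \<omega>) \<partial>M)" if "b \<in> D" for b
    using that by (simp add: F_def N'_def integral_distr)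
  have [measurable]: "F b \<in> borel_measurable N" if "b \<in> D" for b
    using that unfolding F_def[abs_def] by measurable
  have h[measurable]: "h \<in> borel_measurable (\<Pi>\<^sub>M i\<in>{1..n}. N)"
    unfolding h_def[abs_def] by (intro borel_measurable_SUP D(1)) measurable
  have "(\<integral>\<^sup>+\<omega>. h (\<lambda>i\<in>{1..n}. Zs i \<omega>) \<partial>M)
      = (\<integral>\<^sup>+z. h z \<partial>distr M (\<Pi>\<^sub>M i\<in>{1..n}. N) (\<lambda>\<omega>. \<lambda>i\<in>{1..n}. Zs i \<omega>))"
    using h by (intro nn_integral_distr[symmetric] measurable_restrict) (auto simp del: One_nat_def)
  \<comment> \<open>Independence makes the joint law a product, and equality of the laws makes it a
    power of the single law \<open>N'\<close>.\<close>
  also have "distr M (\<Pi>\<^sub>M i\<in>{1..n}. N) (\<lambda>\<omega>. \<lambda>i\<in>{1..n}. Zs i \<omega>) = (\<Pi>\<^sub>M i\<in>{1..n}. distr M N (Zs i))"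
    using ind n by (subst indep_vars_iff_distr_eq_PiM'[symmetric]) auto
  also have "\<dots> = (\<Pi>\<^sub>M i\<in>{1..n}. N')"
    by (intro PiM_cong) (auto simp: eq N'_def)
  also have "(\<integral>\<^sup>+z. h z \<partial>(\<Pi>\<^sub>M i\<in>{1..n}. N')) \<le> ennreal ((\<Sum>j\<in>(UNIV :: 'p set). exp (2 * s * L * r * 0 $ j) + exp (- (2 * s * L * r * 0 $ j)))
        * exp (real (card {1..n}) * ((2 * s * L * r)\<^sup>2 * w / 2)))"
    unfolding h_def
  proof (rule exp_sup_deviation_le[where x = x and v = v])
    show "integrable N' (F b)" if "b \<in> D" for b
      using int[OF that] that by (simp add: F_def N'_def integrable_distr_eq)
    show "\<bar>2 * F b z\<bar> \<le> \<bar>2 * s * L * (b \<bullet> x z)\<bar>" if "b \<in> D" "z \<in> space N'" for b z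
      using mult_left_mono[OF f_le[of b z], of "2 * s"] that s pos by (simp add: F_def space_N' abs_mult)
    show "\<bar>2 * F b z - 2 * F c z\<bar> \<le> \<bar>2 * s * L * (b \<bullet> x z) - 2 * s * L * (c \<bullet> x z)\<bar>"
      if "b \<in> D" "c \<in> D" "z \<in> space N'" for b c z
    proof -
      have "2 * F b z - 2 * F c z = 2 * s * (f b z - f c z)"
        "2 * s * L * (b \<bullet> x z) - 2 * s * L * (c \<bullet> x z) = 2 * s * (L * (b \<bullet> x z - c \<bullet> x z))"
        by (simp_all add: F_def algebra_simps)
      then show ?thesis
        using mult_left_mono[OF f_lip[of b c z], of "2 * s"] that s pos by (simp add: space_N' abs_mult)
    qed
    show "subgaussian N' (v j) (\<lambda>z. x z $ j)" for j
      unfolding N'_def using subg(1) by (subst subgaussian_distr_iff) auto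
  qed (use N' D pos s subg in auto)
  finally have bound: "(\<integral>\<^sup>+\<omega>. h (\<lambda>i\<in>{1..n}. Zs i \<omega>) \<partial>M)
      \<le> ennreal (2 * real CARD('p) * exp (real n * ((2 * s * L * r)\<^sup>2 * w / 2)))"
    by (simp add: mult.commute del: restrict_apply)
  define c where "c = real n * (s * q * r)"
  have [measurable]: "(\<lambda>\<omega>. h (\<lambda>i\<in>{1..n}. Zs i \<omega>)) \<in> borel_measurable M"
    by (intro measurable_compose[OF _ h] measurable_restrict) auto
  have "A \<subseteq> {\<omega>\<in>space M. 1 \<le> ennreal (exp (- c)) * h (\<lambda>i\<in>{1..n}. Zs i \<omega>)}"
  proof
    fix \<omega> assume "\<omega> \<in> A"
    then obtain b where b: "b \<in> D" and \<omega>: "\<omega> \<in> space M"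
      and le: "real n * (q * r) \<le> (\<Sum>i=1..n. (\<integral>\<omega>. f b (Z \<omega>) \<partial>M) - f b (Zs i \<omega>))"
      by (auto simp: A_def)
    have sum_eq: "(\<Sum>i\<in>{1..n}. (\<integral>u. F b u \<partial>N') - F b (Zs i \<omega>))
        = s * (\<Sum>i=1..n. (\<integral>\<omega>. f b (Z \<omega>) \<partial>M) - f b (Zs i \<omega>))"
      unfolding F_int[OF b] by (simp add: F_def sum_distrib_left right_diff_distrib)
    have "1 \<le> exp (- c) * exp (\<Sum>i\<in>{1..n}. (\<integral>u. F b u \<partial>N') - F b (Zs i \<omega>))"
      using mult_left_mono[OF le, of s] s unfolding sum_eq c_def
      by (simp add: exp_add[symmetric] mult_ac)
    then have "1 \<le> ennreal (exp (- c)) * ennreal (exp (\<Sum>i\<in>{1..n}. (\<integral>u. F b u \<partial>N') - F b (Zs i \<omega>)))"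
      by (simp flip: ennreal_mult)
    also have "\<dots> \<le> ennreal (exp (- c)) * h (\<lambda>i\<in>{1..n}. Zs i \<omega>)"
      unfolding h_def by (intro mult_left_mono SUP_upper2[OF b]) auto
    finally show "\<omega> \<in> {\<omega>\<in>space M. 1 \<le> ennreal (exp (- c)) * h (\<lambda>i\<in>{1..n}. Zs i \<omega>)}"
      using \<omega> by simp
  qed
  then have "emeasure M A \<le> emeasure M {\<omega>\<in>space M. 1 \<le> ennreal (exp (- c)) * h (\<lambda>i\<in>{1..n}. Zs i \<omega>)}"
    by (intro emeasure_mono) measurable
  also have "\<dots> \<le> ennreal (exp (- c)) * (\<integral>\<^sup>+\<omega>. h (\<lambda>i\<in>{1..n}. Zs i \<omega>) * indicator (space M) \<omega> \<partial>M)"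
    by (rule nn_integral_Markov_inequality) measurable
  also have "\<dots> = ennreal (exp (- c)) * (\<integral>\<^sup>+\<omega>. h (\<lambda>i\<in>{1..n}. Zs i \<omega>) \<partial>M)"
    by (intro arg_cong2[where f = "(*)"] nn_integral_cong) auto
  also have "\<dots> \<le> ennreal (exp (- c)) * ennreal (2 * real CARD('p) * exp (real n * ((2 * s * L * r)\<^sup>2 * w / 2)))"
    by (intro mult_left_mono bound) auto
  also have "\<dots> = ennreal (2 * real CARD('p) * exp (real n * ((2 * s * L * r)\<^sup>2 * w / 2) - c))"
    by (simp add: exp_diff exp_minus field_simps flip: ennreal_mult)
  also have "real n * ((2 * s * L * r)\<^sup>2 * w / 2) - c = - (real n * q\<^sup>2 / (8 * L\<^sup>2 * w))"
    using pos by (simp add: s_def c_def field_simps power2_eq_square)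
  finally show "measure M A \<le> 2 * real CARD('p) * exp (- (real n * q\<^sup>2 / (8 * L\<^sup>2 * w)))"
    by (simp add: emeasure_eq_measure)
qed

subsection \<open>The penalised convex problem\<close>

lemma l1_norm_on_nonneg: "0 \<le> l1_norm_on S v"
  by (simp add: l1_norm_on_def sum_nonneg)

lemma l1_norm_on_scaleR: "l1_norm_on S (t *\<^sub>R v) = \<bar>t\<bar> * l1_norm_on S v"
  by (simp add: l1_norm_on_def abs_mult sum_distrib_left)

lemma l1_norm_on_triangle: "l1_norm_on S (v + w) \<le> l1_norm_on S v + l1_norm_on S w"
  by (simp add: l1_norm_on_def sum.distrib[symmetric] sum_mono abs_triangle_ineq)

lemma continuous_on_l1_norm_on [continuous_intros]:
  "continuous_on A f \<Longrightarrow> continuous_on A (\<lambda>x. l1_norm_on S (f x))"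
  unfolding l1_norm_on_def by (intro continuous_intros)

lemma l1_norm_split:
  fixes v :: "real ^ 'p::finite"
  shows "l1_norm v = l1_norm_on S v + l1_norm_on (- S) v"
  unfolding l1_norm_on_def
  by (subst sum.union_disjoint[symmetric]) (auto simp: Un_commute)

lemma convex_on_l1_norm: "convex_on UNIV (l1_norm :: real ^ 'p::finite \<Rightarrow> real)"
proof (rule convex_onI)
  fix t :: real and x y :: "real ^ 'p" assume "0 < t" "t < 1"
  then show "l1_norm ((1 - t) *\<^sub>R x + t *\<^sub>R y) \<le> (1 - t) * l1_norm x + t * l1_norm y"
    using l1_norm_on_triangle[of UNIV "(1 - t) *\<^sub>R x" "t *\<^sub>R y"] by (simp add: l1_norm_on_scaleR)
qed simp

lemma compact_l1_ball: "compact (l1_ball r :: (real ^ 'p::finite) set)"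
proof -
  have "closed (l1_ball r :: (real ^ 'p) set)"
    unfolding l1_ball_def by (intro closed_Collect_le continuous_intros)
  moreover have "bounded (l1_ball r :: (real ^ 'p) set)"
    using norm_le_l1_cart order_trans
    by (intro boundedI[where B = r]) (fastforce simp: l1_ball_def l1_norm_on_def)
  ultimately show ?thesis by (simp add: compact_eq_bounded_closed)
qed

text \<open>The segment from \<open>a\<close> to a point outside the ball crosses the sphere, where
  \<open>f\<close> exceeds \<open>f a\<close>; by convexity it exceeds \<open>f a\<close> at the far
  end too. Hence a minimizer over the compact ball is global, and no minimizer lies outside.\<close>

lemma convex_minimizer_in_l1_ball:
  fixes f :: "real ^ 'p::finite \<Rightarrow> real"
  assumes f: "convex_on UNIV f" and r: "0 < r"
    and sphere: "\<And>b. l1_norm (b - a) = r \<Longrightarrow> f a < f b"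
  shows "\<exists>b. is_arg_min f (\<lambda>_. True) b"
    and "is_arg_min f (\<lambda>_. True) b \<Longrightarrow> l1_norm (b - a) \<le> r"
proof -
  have outside: "f a < f b" if b: "r < l1_norm (b - a)" for b
  proof -
    define t where "t = r / l1_norm (b - a)"
    have t: "0 < t" "t < 1" using b r by (auto simp: t_def divide_simps)
    define c where "c = (1 - t) *\<^sub>R a + t *\<^sub>R b"
    have "c - a = t *\<^sub>R (b - a)" by (simp add: c_def algebra_simps)
    then have "l1_norm (c - a) = r" using t b r by (simp add: l1_norm_on_scaleR) (simp add: t_def)
    then have "f a < f c" by (rule sphere)
    also have "f c \<le> (1 - t) * f a + t * f b"
      using convex_onD[OF f, of t a b] t by (simp add: c_def)
    finally have "t * f a < t * f b" by (simp add: algebra_simps)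
    then show ?thesis using t by simp
  qed
  have "continuous_on (l1_ball r) (\<lambda>v. f (a + v))"
    by (intro continuous_on_compose2[OF convex_on_continuous[OF open_UNIV f]] continuous_intros) auto
  moreover have 0: "0 \<in> l1_ball r" using r by (simp add: l1_ball_def l1_norm_on_def)
  ultimately obtain v where v: "v \<in> l1_ball r" "\<And>w. w \<in> l1_ball r \<Longrightarrow> f (a + v) \<le> f (a + w)"
    using continuous_attains_inf[OF compact_l1_ball] by blast
  have "f (a + v) \<le> f b" for b
  proof (cases "b - a \<in> l1_ball r")
    case True
    then show ?thesis using v(2)[OF True] by simp
  next
    case False
    then show ?thesis using outside[of b] v(2)[OF 0] by (simp add: l1_ball_def)
  qed
  then show "\<exists>b. is_arg_min f (\<lambda>_. True) b" by (auto simp: is_arg_min_linorder)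
  show "l1_norm (b - a) \<le> r" if "is_arg_min f (\<lambda>_. True) b"
    using outside[of b] that by (meson is_arg_min_linorder linorder_not_le)
qed

section \<open>Growth of the penalised risk on a sphere\<close>

lemma l1_norm_on_le_sqrt_card_norm:
  fixes v :: "real ^ 'p::finite"
  shows "l1_norm_on S v \<le> sqrt (card S) * norm v"
proof -
  have "(l1_norm_on S v)\<^sup>2 \<le> card S * (\<Sum>j\<in>S. \<bar>v $ j\<bar>\<^sup>2)"
    using sum_squared_le_sum_of_squares[of "\<lambda>j. \<bar>v $ j\<bar>" S] by (simp add: l1_norm_on_def mult.commute)
  also have "\<dots> \<le> card S * (\<Sum>j\<in>UNIV. (v $ j)\<^sup>2)"
    by (intro mult_left_mono) (auto intro: sum_mono2)
  also have "\<dots> = (sqrt (card S) * norm v)\<^sup>2"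
    by (simp add: norm_vec_def L2_set_def power_mult_distrib sum_nonneg)
  finally show ?thesis by (rule power2_le_imp_le) simp
qed

text \<open>Since the deviation \<open>R - E\<close> is so small, the basic inequality puts \<open>b - a\<close> in the cone; the margin
  condition and \<open>2 lam \<surd>s x \<le> \<theta> k x\<^sup>2 / 2 + 2 lam\<^sup>2 s / (\<theta> k)\<close>, with \<open>s = card S\<close>, then force
  \<open>r \<le> r / 2\<close>.\<close>

lemma penalized_risk_increases_on_sphere:
  fixes a b :: "real ^ 'p::finite" and R E :: "real ^ 'p \<Rightarrow> real" and H :: "real ^ 'p ^ 'p"
  defines "S \<equiv> supp a"
  assumes pos: "0 < \<epsilon>" "0 < \<theta>" "0 < lam" "0 < k" "0 < r"
    and min: "R a \<le> R b"
    and margin: "b - a \<in> lasso_cone S \<epsilon> \<Longrightarrow> \<theta> / 2 * ((b - a) \<bullet> (H *v (b - a))) \<le> R b - R a"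
    and k: "\<And>v. v \<in> lasso_cone S \<epsilon> \<Longrightarrow> k * (v \<bullet> v) \<le> v \<bullet> (H *v v)"
    and pen: "2 * real (card S) * lam / (\<theta> * k) \<le> 2 / (4 + \<epsilon>) * r"
    and dev: "(R b - R a) - (E b - E a) \<le> \<epsilon> / (8 + 2 * \<epsilon>) * lam * r"
    and sphere: "l1_norm (b - a) = r"
  shows "E a + lam * l1_norm a < E b + lam * l1_norm b"
proof (rule ccontr)
  assume neg: "\<not> ?thesis"
  define v where "v = b - a"
  define P Q where "P = l1_norm_on S v" and "Q = l1_norm_on (- S) v"
  define q where "q = \<epsilon> / (8 + 2 * \<epsilon>)"
  have PQ: "P + Q = r" "0 \<le> P" "0 \<le> Q"
    using sphere l1_norm_split[of v S] by (auto simp: P_def Q_def v_def l1_norm_on_nonneg)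
  have q: "0 < q" "q < 1/2" "q * (8 + 2 * \<epsilon>) = \<epsilon>" using pos by (auto simp: q_def field_simps)
  have bS: "l1_norm_on S a \<le> l1_norm_on S b + P"
    using l1_norm_on_triangle[of S b "a - b"] by (simp add: P_def v_def l1_norm_on_def abs_minus_commute)
  have "l1_norm_on (- S) a = 0" "l1_norm_on (- S) b = Q"
    by (auto simp: l1_norm_on_def Q_def v_def S_def supp_def intro!: sum.neutral sum.cong)
  then have ab: "l1_norm a - l1_norm b \<le> P - Q"
    using bS l1_norm_split[of a S] l1_norm_split[of b S] by simp
  have basic: "R b - R a \<le> q * lam * r + lam * (P - Q)"
    using neg dev mult_left_mono[OF ab, of lam] pos by (simp add: q_def algebra_simps)
  then have "0 \<le> lam * (q * r + (P - Q))" using min by (simp add: algebra_simps)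
  then have "Q \<le> q * r + P" using pos by (simp add: zero_le_mult_iff)
  \<comment> \<open>Substituting \<open>r = P + Q\<close> turns the bound into a comparison of the
    mass off the support with the mass on it.\<close>
  then have "(1 - q) * Q \<le> (1 + q) * P" unfolding PQ(1)[symmetric] by (simp add: algebra_simps)
  also have "\<dots> \<le> ((1 - q) * (3 + \<epsilon>)) * P"
  proof (intro mult_right_mono PQ)
    have "q * (4 + \<epsilon>) \<le> 2 + \<epsilon>" using q pos by (simp add: algebra_simps)
    then show "1 + q \<le> (1 - q) * (3 + \<epsilon>)" by (simp add: algebra_simps)
  qed
  finally have "Q \<le> (3 + \<epsilon>) * P" using q by (simp add: mult.assoc)
  then have cone: "v \<in> lasso_cone S \<epsilon>" by (simp add: lasso_cone_def P_def Q_def)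
  define s where "s = real (card S)"
  have "\<theta> / 2 * (k * (v \<bullet> v)) \<le> \<theta> / 2 * (v \<bullet> (H *v v))"
    using k[OF cone] pos by (intro mult_left_mono) auto
  also have "\<dots> \<le> R b - R a" using margin cone by (simp add: v_def)
  finally have 1: "\<theta> * k / 2 * (norm v)\<^sup>2 \<le> q * lam * r + lam * (P - Q)"
    using basic by (simp add: power2_norm_eq_inner)
  have 2: "2 * lam * P \<le> \<theta> * k / 2 * (norm v)\<^sup>2 + 2 * lam\<^sup>2 * s / (\<theta> * k)"
  proof -
    have tk: "0 < \<theta> * k" using pos by simp
    have "2 * lam * P \<le> 2 * lam * (sqrt s * norm v)"
      using l1_norm_on_le_sqrt_card_norm[of S v] pos by (intro mult_left_mono) (auto simp: P_def s_def)
    moreover have "0 \<le> (\<theta> * k * norm v - 2 * lam * sqrt s)\<^sup>2 / (2 * (\<theta> * k))"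
      using tk by (intro divide_nonneg_pos) auto
    moreover have "(\<theta> * k * norm v - 2 * lam * sqrt s)\<^sup>2 / (2 * (\<theta> * k))
       = \<theta> * k / 2 * (norm v)\<^sup>2 + 2 * lam\<^sup>2 * s / (\<theta> * k) - 2 * lam * (sqrt s * norm v)"
      using pos by (simp add: power2_diff power_mult_distrib s_def) (simp add: field_simps power2_eq_square)
    ultimately show ?thesis by linarith
  qed
  \<comment> \<open>Split this way, the first summand is bounded by \<open>1\<close> and the second
    by \<open>2\<close>, and the quadratic terms in \<open>norm v\<close> cancel.\<close>
  have "lam * r = lam * (Q - P) + 2 * lam * P" using PQ by (simp add: algebra_simps flip: PQ(1))
  also have "\<dots> \<le> lam * (q * r + 2 * s * lam / (\<theta> * k))"
    using 1 2 by (simp add: algebra_simps power2_eq_square)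
  finally have "r \<le> q * r + 2 * s * lam / (\<theta> * k)" using pos by simp
  also have "\<dots> \<le> q * r + 2 / (4 + \<epsilon>) * r" using pen by (simp add: s_def)
  \<comment> \<open>Since \<open>q = \<epsilon> / (2 * (4 + \<epsilon>))\<close>, the two
    coefficients of \<open>r\<close> add up to 1/2.\<close>
  also have "\<dots> = r / 2"
  proof -
    have "q * (4 + \<epsilon>) = \<epsilon> / 2" using q(3) by (simp add: algebra_simps)
    moreover have "2 / (4 + \<epsilon>) * (4 + \<epsilon>) = 2" using pos by (subst nonzero_eq_divide_eq[symmetric]) auto
    ultimately have "(q + 2 / (4 + \<epsilon>)) * (4 + \<epsilon>) = 1 / 2 * (4 + \<epsilon>)"
      unfolding distrib_right by simp
    then have "q + 2 / (4 + \<epsilon>) = 1 / 2" using pos by (simp only: mult_cancel_right) linarith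
    then have "(q + 2 / (4 + \<epsilon>)) * r = r / 2" by simp
    then show ?thesis by (simp only: distrib_right)
  qed
  finally show False using pos by simp
qed

text \<open>For small \<open>u\<close> the right side is at least 1. Otherwise, with
  \<open>l\<close> the logarithm, \<open>2 * p <= exp (2 * l) <= exp (u\<^sup>2 / 32)\<close>
  absorbs the dimension, and what remains of the Gaussian factor is below \<open>4 / u\<close>.
  Finally \<open>sqrt l >= 1/2\<close>.\<close>

lemma subgaussian_tail_le_linear:
  fixes u :: real and p :: nat
  assumes u: "0 < u" and p: "1 \<le> p"
  shows "min 1 (2 * real p * exp (- (u\<^sup>2 / 8))) \<le> 8 * sqrt (ln (real (max p 2))) / u"
proof (cases "u \<le> 8 * sqrt (ln (real (max p 2)))")
  case True
  then show ?thesis using u by (simp add: min_le_iff_disj)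
next
  case False
  define l where "l = ln (real (max p 2))"
  have "ln 2 \<le> l" unfolding l_def by (subst ln_le_cancel_iff) auto
  then have l: "1/4 \<le> l" using ln2_ge_two_thirds by linarith
  have "64 * l = (8 * sqrt l)\<^sup>2" using l by (simp add: power_mult_distrib)
  also have "\<dots> \<le> u\<^sup>2" using False l by (intro power_mono) (auto simp: l_def)
  finally have ul: "2 * l \<le> u\<^sup>2 / 32" by simp
  have "2 * real p \<le> real (max p 2) * real (max p 2)"
    by (intro mult_mono) auto
  also have "\<dots> = exp (2 * l)" by (simp add: l_def exp_double power2_eq_square)
  also have "\<dots> \<le> exp (u\<^sup>2 / 32)" using ul by simp
  finally have "2 * real p * exp (- (u\<^sup>2 / 8)) \<le> exp (u\<^sup>2 / 32) * exp (- (u\<^sup>2 / 8))"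
    by (rule mult_right_mono) simp
  also have "\<dots> = inverse (exp (3 * u\<^sup>2 / 32))" by (simp add: exp_add[symmetric] exp_minus[symmetric])
  also have "\<dots> \<le> inverse (1 + 3 * u\<^sup>2 / 32)"
    by (intro le_imp_inverse_le exp_ge_add_one_self add_pos_nonneg) auto
  also have "\<dots> \<le> 4 / u"
  proof -
    have "0 \<le> (3 * u - 4)\<^sup>2" by simp
    then have "u \<le> 4 * (1 + 3 * u\<^sup>2 / 32)" by (simp add: power2_eq_square algebra_simps)
    then show ?thesis using u by (simp add: field_simps add_pos_nonneg)
  qed
  also have "\<dots> \<le> 8 * sqrt l / u"
  proof -
    have "sqrt (1/4) \<le> sqrt l" using l by (rule real_sqrt_le_mono)
    then have "4 \<le> 8 * sqrt l" by (simp add: real_sqrt_divide)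
    then show ?thesis using u by (intro divide_right_mono) auto
  qed
  finally show ?thesis by (simp add: l_def min_le_iff_disj)
qed

subsection \<open>Risk, penalty and consistency\<close>

lemma Lipschitz_continuous_on_UNIV:
  fixes g :: "real \<Rightarrow> real"
  assumes "0 < L" "\<And>s t. \<bar>g s - g t\<bar> \<le> L * \<bar>s - t\<bar>"
  shows "continuous_on UNIV g"
  by (rule lipschitz_on_continuous_on[of L]) (use assms in \<open>auto simp: lipschitz_on_def dist_real_def\<close>)

text \<open>Continuity is known for each label separately, so the loss is written as a case
  distinction on the label.\<close>

lemma borel_measurable_loss:
  fixes \<rho> :: "real \<Rightarrow> nat \<Rightarrow> real"
  assumes "\<And>y. y \<in> {0, 1} \<Longrightarrow> continuous_on UNIV (\<lambda>t. \<rho> t y)"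
  shows "(\<lambda>z. \<rho> (b \<bullet> fst z) (snd z)) \<in> borel_measurable (obs_space :: ((real ^ 'p::finite) \<times> nat) measure)"
proof -
  have [measurable]: "(\<lambda>z. \<rho> (b \<bullet> fst z) y) \<in> borel_measurable (obs_space :: ((real ^ 'p) \<times> nat) measure)"
    if "y \<in> {0, 1}" for y
    by (rule borel_measurable_continuous_on[OF assms[OF that]]) measurable
  have "(\<lambda>z. if snd z = 0 then \<rho> (b \<bullet> fst z) 0 else \<rho> (b \<bullet> fst z) 1)
      \<in> borel_measurable (obs_space :: ((real ^ 'p) \<times> nat) measure)"
    by measurable
  then show ?thesis
    by (rule measurable_cong[THEN iffD1, rotated]) (auto simp: space_pair_measure)
qed

lemma convex_on_loss_inner:
  assumes "convex_on UNIV g"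
  shows "convex_on UNIV (\<lambda>b. g (b \<bullet> x))"
proof (rule convex_onI)
  fix t :: real and b c assume "0 < t" "t < 1"
  then show "g (((1 - t) *\<^sub>R b + t *\<^sub>R c) \<bullet> x) \<le> (1 - t) * g (b \<bullet> x) + t * g (c \<bullet> x)"
    using convex_onD[OF assms, of t "b \<bullet> x" "c \<bullet> x"] by (simp add: inner_add_left)
qed simp

lemma convex_on_risk:
  assumes "\<And>\<omega>. \<omega> \<in> space M \<Longrightarrow> convex_on UNIV (\<lambda>t. \<rho> t (Y \<omega>))"
    and "\<And>b. integrable M (\<lambda>\<omega>. \<rho> (b \<bullet> X \<omega>) (Y \<omega>))"
  shows "convex_on UNIV (risk M \<rho> X Y)"
proof (rule convex_onI)
  fix t :: real and b c :: "real ^ 'b" assume t: "0 < t" "t < 1"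
  have "risk M \<rho> X Y ((1 - t) *\<^sub>R b + t *\<^sub>R c)
      \<le> (\<integral>\<omega>. (1 - t) * \<rho> (b \<bullet> X \<omega>) (Y \<omega>) + t * \<rho> (c \<bullet> X \<omega>) (Y \<omega>) \<partial>M)"
    unfolding risk_def
  proof (intro integral_mono)
    fix \<omega> assume "\<omega> \<in> space M"
    then show "\<rho> (((1 - t) *\<^sub>R b + t *\<^sub>R c) \<bullet> X \<omega>) (Y \<omega>)
        \<le> (1 - t) * \<rho> (b \<bullet> X \<omega>) (Y \<omega>) + t * \<rho> (c \<bullet> X \<omega>) (Y \<omega>)"
      using t convex_onD[OF convex_on_loss_inner[OF assms(1)], of \<omega> t b c "X \<omega>"] by simp
  qed (use assms(2) in auto)
  also have "\<dots> = (1 - t) * risk M \<rho> X Y b + t * risk M \<rho> X Y c"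
    unfolding risk_def using assms(2) by simp
  finally show "risk M \<rho> X Y ((1 - t) *\<^sub>R b + t *\<^sub>R c) \<le> \<dots>" .
qed simp

lemma convex_on_emp_risk:
  assumes "\<And>i. i \<in> {1..n} \<Longrightarrow> convex_on UNIV (\<lambda>t. \<rho> t (ys i))"
  shows "convex_on UNIV (emp_risk \<rho> n xs ys)"
proof -
  have "convex_on UNIV (\<lambda>b. \<Sum>i\<in>I. \<rho> (b \<bullet> xs i) (ys i))" if "I \<subseteq> {1..n}" for I
    using finite_subset[OF that finite_atLeastAtMost] that
  proof (induction I rule: finite_induct)
    case (insert i I)
    then show ?case using convex_on_add[OF convex_on_loss_inner[OF assms[of i], of "xs i"] insert.IH] by simp
  qed (simp_all add: convex_on_const)
  then have "convex_on UNIV (\<lambda>b. inverse (real n) * (\<Sum>i=1..n. \<rho> (b \<bullet> xs i) (ys i)))"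
    by (intro convex_on_cmul) auto
  then show ?thesis by (simp add: emp_risk_def[abs_def] field_simps)
qed

text \<open>The Lipschitz condition compares the loss with its value at 0. Adding the values for
  both labels gives a dominating function free of \<open>Y\<close>.\<close>

lemma integrable_loss:
  fixes X :: "'a \<Rightarrow> real ^ 'p::finite"
  assumes "prob_space M"
    and L: "\<And>\<omega> s t. \<omega> \<in> space M \<Longrightarrow> \<bar>\<rho> s (Y \<omega>) - \<rho> t (Y \<omega>)\<bar> \<le> L * \<bar>s - t\<bar>"
    and Y: "\<And>\<omega>. \<omega> \<in> space M \<Longrightarrow> Y \<omega> \<in> {0, 1 :: nat}"
    and X: "\<And>j. integrable M (\<lambda>\<omega>. X \<omega> $ j)"
    and meas: "(\<lambda>\<omega>. \<rho> (b \<bullet> X \<omega>) (Y \<omega>)) \<in> borel_measurable M"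
  shows "integrable M (\<lambda>\<omega>. \<rho> (b \<bullet> X \<omega>) (Y \<omega>))"
proof -
  interpret prob_space M by fact
  show ?thesis
  proof (rule Bochner_Integration.integrable_bound[OF _ meas])
    show "integrable M (\<lambda>\<omega>. \<bar>\<rho> 0 0\<bar> + \<bar>\<rho> 0 1\<bar> + L * \<bar>b \<bullet> X \<omega>\<bar>)"
      unfolding inner_vec_def using X by auto
    show "AE \<omega> in M. norm (\<rho> (b \<bullet> X \<omega>) (Y \<omega>)) \<le> norm (\<bar>\<rho> 0 0\<bar> + \<bar>\<rho> 0 1\<bar> + L * \<bar>b \<bullet> X \<omega>\<bar>)"
    proof (rule AE_I2)
      fix \<omega> assume \<omega>: "\<omega> \<in> space M"
      show "norm (\<rho> (b \<bullet> X \<omega>) (Y \<omega>)) \<le> norm (\<bar>\<rho> 0 0\<bar> + \<bar>\<rho> 0 1\<bar> + L * \<bar>b \<bullet> X \<omega>\<bar>)"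
        using L[OF \<omega>, of "b \<bullet> X \<omega>" 0] Y[OF \<omega>] by auto
    qed
  qed
qed

text \<open>Passes from the extended real \<open>kappa\<close> to a positive real \<open>k\<close>:
  a cone vector bounds it above, definiteness of \<open>H\<close> bounds it below by 0, and the
  value 0 would make the ratio in \<open>pen\<close> infinite.\<close>

lemma kappa_penaltyE:
  fixes H :: "real ^ 'p ^ 'p::finite"
  assumes pos: "0 < \<epsilon>" "0 < \<theta>" "0 < lam" and H: "nonneg_definite H"
    and ne: "supp a \<noteq> {}"
    and pen: "ereal (2 * real (card (supp a)) * lam) / (ereal \<theta> * kappa H (supp a) \<epsilon>) \<le> ereal C"
  obtains k where "0 < k" "2 * real (card (supp a)) * lam / (\<theta> * k) \<le> C"
    "\<And>v. v \<in> lasso_cone (supp a) \<epsilon> \<Longrightarrow> k * (v \<bullet> v) \<le> v \<bullet> (H *v v)"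
proof -
  let ?S = "supp a"
  let ?K = "kappa H ?S \<epsilon>"
  \<comment> \<open>The indicator of the support is a nonzero element of the cone, so the infimum is
    not over the empty set.\<close>
  define e :: "real ^ 'p" where "e = (\<chi> j. if j \<in> ?S then 1 else 0)"
  obtain j0 where j0: "j0 \<in> ?S" using ne by auto
  have "l1_norm_on (- ?S) e = 0" by (auto simp: l1_norm_on_def e_def)
  then have "e \<in> lasso_cone ?S \<epsilon>" using pos l1_norm_on_nonneg[of ?S e] by (simp add: lasso_cone_def)
  moreover have "e \<noteq> 0" using j0 by (auto simp: e_def vec_eq_iff)
  ultimately have "?K \<le> ereal ((e \<bullet> (H *v e)) / (e \<bullet> e))"
    unfolding kappa_def by (intro INF_lower) auto
  moreover have "0 \<le> ?K"
    unfolding kappa_def using H by (intro INF_greatest) (auto simp: nonneg_definite_def intro!: divide_nonneg_nonneg)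
  ultimately obtain k where k: "?K = ereal k" "0 \<le> k"
    by (cases ?K) auto
  have num: "0 < 2 * real (card ?S) * lam" using ne pos by (simp add: card_gt_0_iff)
  have "k \<noteq> 0"
  proof
    assume "k = 0"
    then have "?K = 0" using k by (simp add: zero_ereal_def)
    then have "ereal (2 * real (card ?S) * lam) * \<infinity> \<le> ereal C"
      using pen by (simp add: divide_ereal_def)
    moreover have "ereal c * \<infinity> = (\<infinity> :: ereal)" if "0 < c" for c using that by simp
    note this[OF num]
    ultimately show False by simp
  qed
  then have "0 < k" using k by simp
  moreover have "2 * real (card ?S) * lam / (\<theta> * k) \<le> C"
    using pen k \<open>0 < k\<close> pos by simp
  moreover have "k * (v \<bullet> v) \<le> v \<bullet> (H *v v)" if "v \<in> lasso_cone ?S \<epsilon>" for v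
  proof (cases "v = 0")
    case False
    then have "ereal k \<le> ereal ((v \<bullet> (H *v v)) / (v \<bullet> v))"
      using that unfolding k(1)[symmetric] kappa_def by (intro INF_lower) auto
    then show ?thesis using False by (simp add: pos_le_divide_eq)
  qed simp
  ultimately show ?thesis by (rule that)
qed

theorem theorem1:
  fixes M :: "'a measure"
    and n :: nat
    and X :: "'a \<Rightarrow> real ^ 'p::finite" and Y :: "'a \<Rightarrow> nat"
    and Xs :: "nat \<Rightarrow> 'a \<Rightarrow> real ^ 'p" and Ys :: "nat \<Rightarrow> 'a \<Rightarrow> nat"
    and \<rho> :: "real \<Rightarrow> nat \<Rightarrow> real"
    and \<sigma> :: "'p \<Rightarrow> real"
    and L \<epsilon> \<delta> \<theta> lam :: real
    and H :: "real ^ 'p ^ 'p"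
    and bs :: "real ^ 'p"
    and bhat :: "'a \<Rightarrow> real ^ 'p"
  assumes "prob_space M"
    and "n \<ge> 1"
    and "iid_copies M obs_space (\<lambda>\<omega>. (X \<omega>, Y \<omega>)) n (\<lambda>i \<omega>. (Xs i \<omega>, Ys i \<omega>))"
    and lin_indep: "\<forall>a c. a \<noteq> 0 \<longrightarrow> \<not> (AE \<omega> in M. a \<bullet> X \<omega> = c)"
    and convex: "\<forall>y\<in>{0, 1}. convex_on UNIV (\<lambda>t. \<rho> t y)"
    and lipschitz: "L > 0"
      "\<forall>y\<in>{0, 1}. \<forall>t1 t2. \<bar>\<rho> t1 y - \<rho> t2 y\<bar> \<le> L * \<bar>t1 - t2\<bar>"
    and subg: "\<forall>j. \<sigma> j \<ge> 0"
      "\<forall>i\<in>{1..n}. \<forall>j. subgaussian M ((\<sigma> j)\<^sup>2) (\<lambda>\<omega>. Xs i \<omega> $ j)"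
    and bs: "is_arg_min (risk M \<rho> X Y) (\<lambda>_. True) bs"
      "\<forall>b. is_arg_min (risk M \<rho> X Y) (\<lambda>_. True) b \<longrightarrow> b = bs"
    and margin: "\<epsilon> > 0" "\<delta> > 0" "\<theta> > 0" "nonneg_definite H"
      "\<forall>b. b - bs \<in> lasso_cone (supp bs) \<epsilon> \<inter> l1_ball \<delta> \<longrightarrow>
         risk M \<rho> X Y b - risk M \<rho> X Y bs \<ge> \<theta> / 2 * ((b - bs) \<bullet> (H *v (b - bs)))"
    and penalty: "lam > 0"
      "ereal (2 * real (card (supp bs)) * lam) / (ereal \<theta> * kappa H (supp bs) \<epsilon>)
         \<le> ereal (2 / (4 + \<epsilon>)) * min (min_signal bs / 2) (ereal \<delta>)"
    and bhat: "bhat \<in> borel_measurable M"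
      "\<forall>\<omega>\<in>space M. (\<exists>b. is_lasso \<rho> lam n (\<lambda>i. Xs i \<omega>) (\<lambda>i. Ys i \<omega>) b) \<longrightarrow>
         is_lasso \<rho> lam n (\<lambda>i. Xs i \<omega>) (\<lambda>i. Ys i \<omega>) (bhat \<omega>)"
  shows "measure M {\<omega> \<in> space M. ereal (l1_norm (bhat \<omega> - bs)) \<le> min_signal bs / 2}
    \<ge> 1 - 8 * (8 + 2 * \<epsilon>) * L * Max (range \<sigma>) * sqrt (ln (real (max CARD('p) 2)))
          / (\<epsilon> * lam * sqrt (real n))"
proof -
  interpret prob_space M by fact
  have Z[measurable]: "(\<lambda>\<omega>. (X \<omega>, Y \<omega>)) \<in> measurable M obs_space"
    and ind: "indep_vars (\<lambda>_. obs_space) (\<lambda>i \<omega>. (Xs i \<omega>, Ys i \<omega>)) {1..n}"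
    and eq: "\<And>i. i \<in> {1..n} \<Longrightarrow> distr M obs_space (\<lambda>\<omega>. (Xs i \<omega>, Ys i \<omega>)) = distr M obs_space (\<lambda>\<omega>. (X \<omega>, Y \<omega>))"
    using assms(3) by (auto simp: iid_copies_def)
  have Zs: "(\<lambda>\<omega>. (Xs i \<omega>, Ys i \<omega>)) \<in> measurable M obs_space" if "i \<in> {1..n}" for i
    using ind that by (auto simp: indep_vars_def)
  have Y01: "Y \<omega> \<in> {0, 1}" if "\<omega> \<in> space M" for \<omega>
    using measurable_space[OF Z that] by (auto simp: space_pair_measure)
  have Ys01: "Ys i \<omega> \<in> {0, 1}" if "\<omega> \<in> space M" "i \<in> {1..n}" for i \<omega>
    using measurable_space[OF Zs[OF that(2)] that(1)] by (auto simp: space_pair_measure)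
  have X_meas[measurable]: "X \<in> borel_measurable M"
    using measurable_compose[OF Z measurable_fst] by simp
  have Xj_meas: "(\<lambda>\<omega>. X \<omega> $ j) \<in> borel_measurable M" for j
    by (rule borel_measurable_continuous_on[OF _ X_meas]) (intro continuous_intros)
  have fst_nth[measurable]: "(\<lambda>z. fst z $ j) \<in> borel_measurable (obs_space :: ((real ^ 'p) \<times> nat) measure)" for j
    by (rule borel_measurable_continuous_on[OF _ measurable_fst]) (intro continuous_intros)
  \<comment> \<open>Subgaussianity is assumed for the sample; it reaches \<open>X\<close> through
    the common law, with the first observation as representative.\<close>
  have subgX: "subgaussian M ((\<sigma> j)\<^sup>2) (\<lambda>\<omega>. X \<omega> $ j)" for j
  proof -
    have 1: "1 \<in> {1..n}" using assms(2) by simp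
    have "subgaussian (distr M obs_space (\<lambda>\<omega>. (Xs 1 \<omega>, Ys 1 \<omega>))) ((\<sigma> j)\<^sup>2) (\<lambda>z. fst z $ j)"
      using subg(2) 1 by (subst subgaussian_distr_iff[OF Zs[OF 1] fst_nth]) simp
    then show ?thesis
      unfolding eq[OF 1] by (subst (asm) subgaussian_distr_iff[OF Z fst_nth]) simp
  qed
  have loss_cont: "continuous_on UNIV (\<lambda>t. \<rho> t y)" if "y \<in> {0, 1}" for y
    using lipschitz that by (intro Lipschitz_continuous_on_UNIV[of L]) auto
  have loss_meas[measurable]: "(\<lambda>z. \<rho> (b \<bullet> fst z) (snd z)) \<in> borel_measurable (obs_space :: ((real ^ 'p) \<times> nat) measure)" for b
    using loss_cont by (rule borel_measurable_loss)
  have loss_int: "integrable M (\<lambda>\<omega>. \<rho> (b \<bullet> X \<omega>) (Y \<omega>))" for b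
  proof (rule integrable_loss[OF assms(1), of \<rho> Y L])
    show "\<bar>\<rho> s (Y \<omega>) - \<rho> t (Y \<omega>)\<bar> \<le> L * \<bar>s - t\<bar>" if "\<omega> \<in> space M" for \<omega> s t
      using lipschitz(2) Y01[OF that] by blast
    show "integrable M (\<lambda>\<omega>. X \<omega> $ j)" for j
      using subgX Xj_meas by (rule subgaussian_integrable)
    show "(\<lambda>\<omega>. \<rho> (b \<bullet> X \<omega>) (Y \<omega>)) \<in> borel_measurable M"
      using measurable_compose[OF Z loss_meas] by simp
  qed (use Y01 in auto)
  let ?R = "risk M \<rho> X Y"
  let ?E = "\<lambda>\<omega>. emp_risk \<rho> n (\<lambda>i. Xs i \<omega>) (\<lambda>i. Ys i \<omega>)"
  have R_convex: "convex_on UNIV ?R"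
    using convex Y01 by (intro convex_on_risk loss_int) blast
  have E_convex: "convex_on UNIV (?E \<omega>)" if "\<omega> \<in> space M" for \<omega>
    using convex Ys01[OF that] by (intro convex_on_emp_risk) blast
  define G where "G = {\<omega> \<in> space M. ereal (l1_norm (bhat \<omega> - bs)) \<le> min_signal bs / 2}"
  have l1_meas: "(\<lambda>\<omega>. l1_norm (bhat \<omega> - bs)) \<in> borel_measurable M"
    by (intro borel_measurable_continuous_on[OF _ bhat(1), of "\<lambda>b. l1_norm (b - bs)"] continuous_intros)
  have G: "G \<in> events"
    using l1_meas unfolding G_def by measurable
  (* s is only an upper bound because Max (range \<sigma>) may be 0, where the exponential bound degenerates. *)
  have main: "1 - 8 * (8 + 2 * \<epsilon>) * L * s * sqrt (ln (real (max CARD('p) 2))) / (\<epsilon> * lam * sqrt (real n)) \<le> prob G"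
    if s: "0 < s" "\<And>j. \<sigma> j \<le> s" for s
  proof (cases "supp bs = {}")
    case True
    \<comment> \<open>The minimum over the empty support is infinite, so the event is
      certain.\<close>
    then have "G = space M" by (auto simp: G_def min_signal_def top_ereal_def)
    moreover have "0 \<le> 8 * (8 + 2 * \<epsilon>) * L * s * sqrt (ln (real (max CARD('p) 2))) / (\<epsilon> * lam * sqrt (real n))"
      using s lipschitz(1) margin(1) penalty(1) by (intro divide_nonneg_nonneg mult_nonneg_nonneg) auto
    ultimately show ?thesis by (simp add: prob_space)
  next
    case False
    obtain m where m: "min_signal bs = ereal m" "0 < m"
    proof -
      have "min_signal bs = Min ((\<lambda>j. ereal \<bar>bs $ j\<bar>) ` supp bs)"
        unfolding min_signal_def using False by (intro Min_Inf[symmetric]) auto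
      then have "min_signal bs \<in> (\<lambda>j. ereal \<bar>bs $ j\<bar>) ` supp bs"
        using Min_in[of "(\<lambda>j. ereal \<bar>bs $ j\<bar>) ` supp bs"] False by auto
      then show ?thesis using that by (auto simp: supp_def)
    qed
    define r where "r = min (m / 2) \<delta>"
    have r: "0 < r" "r \<le> m / 2" "r \<le> \<delta>" using m margin by (auto simp: r_def)
    have "min (min_signal bs / 2) (ereal \<delta>) = ereal r" by (simp add: m r_def min_def)
    then have "ereal (2 / (4 + \<epsilon>)) * min (min_signal bs / 2) (ereal \<delta>) = ereal (2 / (4 + \<epsilon>) * r)"
      by simp
    then obtain k where k: "0 < k" "2 * real (card (supp bs)) * lam / (\<theta> * k) \<le> 2 / (4 + \<epsilon>) * r"
      "\<And>v. v \<in> lasso_cone (supp bs) \<epsilon> \<Longrightarrow> k * (v \<bullet> v) \<le> v \<bullet> (H *v v)"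
      using kappa_penaltyE[OF margin(1,3) penalty(1) margin(4) False] penalty(2) by metis
    \<comment> \<open>A countable dense subset is enough for the supremum; continuity recovers the
      whole ball below.\<close>
    obtain D :: "(real ^ 'p) set" where D: "countable D" "D \<subseteq> l1_ball r" "l1_ball r \<subseteq> closure D"
      using separable by blast
    \<comment> \<open>Loss increments from \<open>bs\<close> vanish at \<open>b = 0\<close>, so the
      Lipschitz condition bounds them by \<open>L * |b \<bullet> fst z|\<close>, as contraction
      requires.\<close>
    define f where "f b z = \<rho> ((bs + b) \<bullet> fst z) (snd z) - \<rho> (bs \<bullet> fst z) (snd z)"
      for b :: "real ^ 'p" and z :: "(real ^ 'p) \<times> nat"
    define q where "q = \<epsilon> / (8 + 2 * \<epsilon>) * lam"
    have q: "0 < q" using margin penalty by (simp add: q_def)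
    define A where "A = {\<omega>\<in>space M. \<exists>b\<in>D. real n * (q * r) \<le>
      (\<Sum>i=1..n. (\<integral>\<omega>. f b (X \<omega>, Y \<omega>) \<partial>M) - f b (Xs i \<omega>, Ys i \<omega>))}"
    let ?N = "obs_space :: ((real ^ 'p) \<times> nat) measure"
    have lip: "\<bar>\<rho> t1 (snd z) - \<rho> t2 (snd z)\<bar> \<le> L * \<bar>t1 - t2\<bar>" if "z \<in> space ?N" for z t1 t2
      using lipschitz(2) that by (auto simp: space_pair_measure)
    have f_meas: "f b \<in> borel_measurable ?N" for b
      unfolding f_def[abs_def] by (intro borel_measurable_diff loss_meas)
    have f_int: "integrable M (\<lambda>\<omega>. f b (X \<omega>, Y \<omega>))" for b
      using loss_int by (simp add: f_def)
    have f_le: "\<bar>f b z\<bar> \<le> L * \<bar>b \<bullet> fst z\<bar>" if "z \<in> space ?N" for b z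
      using lip[OF that, of "(bs + b) \<bullet> fst z" "bs \<bullet> fst z"] by (simp add: f_def inner_add_left)
    have f_lip: "\<bar>f b z - f c z\<bar> \<le> L * \<bar>b \<bullet> fst z - c \<bullet> fst z\<bar>" if "z \<in> space ?N" for b c z
      using lip[OF that, of "(bs + b) \<bullet> fst z" "(bs + c) \<bullet> fst z"] by (simp add: f_def inner_add_left)
    have fst_subg: "subgaussian M ((\<sigma> j)\<^sup>2) (\<lambda>\<omega>. fst (X \<omega>, Y \<omega>) $ j)" for j
      using subgX by simp
    have var_le: "(\<sigma> j)\<^sup>2 \<le> s\<^sup>2" for j
      using s(2) subg(1) by (intro power_mono) auto
    have s2: "0 < s\<^sup>2" using s by simp
    note tail = sup_deviation_tail[OF assms(1-3) D(1,2) r(1) lipschitz(1) s2 q measurable_fst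
        f_meas f_int f_le f_lip fst_subg var_le]
    have A: "A \<in> events" "prob A \<le> 2 * real CARD('p) * exp (- (real n * q\<^sup>2 / (8 * L\<^sup>2 * s\<^sup>2)))"
      unfolding A_def by (rule tail(1), assumption+) (rule tail(2), assumption+)
    have G_sup: "\<omega> \<in> G" if \<omega>: "\<omega> \<in> space M - A" for \<omega>
    proof -
      have E_diff: "?E \<omega> (bs + b) - ?E \<omega> bs = (\<Sum>i=1..n. f b (Xs i \<omega>, Ys i \<omega>)) / real n" for b
        by (simp add: emp_risk_def f_def sum_subtractf diff_divide_distrib)
      have R_diff: "?R (bs + b) - ?R bs = (\<integral>\<omega>. f b (X \<omega>, Y \<omega>) \<partial>M)" for b
        using loss_int by (simp add: risk_def f_def)
      let ?d = "\<lambda>b. (?R (bs + b) - ?R bs) - (?E \<omega> (bs + b) - ?E \<omega> bs)"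
      have "?d b \<le> q * r" if "b \<in> D" for b
      proof -
        have "(\<Sum>i=1..n. (\<integral>\<omega>. f b (X \<omega>, Y \<omega>) \<partial>M) - f b (Xs i \<omega>, Ys i \<omega>)) < real n * (q * r)"
          using \<omega> that by (force simp: A_def)
        then have "real n * ?d b \<le> real n * (q * r)"
          using assms(2) unfolding E_diff R_diff by (simp add: sum_subtractf right_diff_distrib)
        then show ?thesis using assms(2) by simp
      qed
      \<comment> \<open>Finite convex functions are continuous, so the bound on \<open>D\<close>
        extends to its closure, which contains the ball.\<close>
      moreover have "continuous_on UNIV ?d"
        using \<omega> by (intro continuous_intros continuous_on_compose2[OF convex_on_continuous[OF open_UNIV R_convex]]
            continuous_on_compose2[OF convex_on_continuous[OF open_UNIV E_convex]]) auto
      ultimately have dev: "?d b \<le> q * r" if "b \<in> l1_ball r" for b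
        using continuous_le_on_closure[of D ?d b "q * r"] D(3) that continuous_on_subset by blast
      let ?obj = "\<lambda>b. ?E \<omega> b + lam * l1_norm b"
      have sphere: "?obj bs < ?obj b" if b: "l1_norm (b - bs) = r" for b
      proof (rule penalized_risk_increases_on_sphere[OF margin(1,3) penalty(1) k(1) r(1) _ _ k(3) k(2) _ b])
        show "?R bs \<le> ?R b" using bs(1) by (simp add: is_arg_min_linorder)
        show "\<theta> / 2 * ((b - bs) \<bullet> (H *v (b - bs))) \<le> ?R b - ?R bs" if "b - bs \<in> lasso_cone (supp bs) \<epsilon>"
          using margin(5) that b r by (simp add: l1_ball_def)
        show "?R b - ?R bs - (?E \<omega> b - ?E \<omega> bs) \<le> \<epsilon> / (8 + 2 * \<epsilon>) * lam * r"
          using dev[of "b - bs"] b by (simp add: l1_ball_def q_def)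
      qed
      have obj: "convex_on UNIV ?obj"
        using \<omega> penalty(1) by (intro convex_on_add E_convex convex_on_cmul convex_on_l1_norm) auto
      \<comment> \<open>The estimator is a Lasso solution only at sample points where one exists, so
        existence has to come first.\<close>
      have "\<exists>b. is_arg_min ?obj (\<lambda>_. True) b"
        by (rule convex_minimizer_in_l1_ball(1)[OF obj r(1)]) (rule sphere)
      then have "is_lasso \<rho> lam n (\<lambda>i. Xs i \<omega>) (\<lambda>i. Ys i \<omega>) (bhat \<omega>)"
        using bhat(2) \<omega> unfolding is_lasso_def by blast
      then have "l1_norm (bhat \<omega> - bs) \<le> r"
        unfolding is_lasso_def by (rule convex_minimizer_in_l1_ball(2)[OF obj r(1), rotated]) (rule sphere)
      then show ?thesis using \<omega> r(2) by (simp add: G_def m)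
    qed
    \<comment> \<open>Chosen so that the exponent of the tail bound becomes
      \<open>- (u\<^sup>2 / 8)\<close>.\<close>
    define u where "u = sqrt (real n) * q / (L * s)"
    have u: "0 < u" using assms(2) q s lipschitz by (simp add: u_def)
    have "prob A \<le> min 1 (2 * real CARD('p) * exp (- (u\<^sup>2 / 8)))"
      using A(2) by (simp add: u_def power_divide power_mult_distrib mult_ac)
    also have "\<dots> \<le> 8 * sqrt (ln (real (max CARD('p) 2))) / u"
      using u by (intro subgaussian_tail_le_linear) (simp_all add: Suc_leI)
    also have "\<dots> = 8 * (8 + 2 * \<epsilon>) * L * s * sqrt (ln (real (max CARD('p) 2))) / (\<epsilon> * lam * sqrt (real n))"
      by (simp add: u_def q_def algebra_simps)
    finally have "prob A \<le> 8 * (8 + 2 * \<epsilon>) * L * s * sqrt (ln (real (max CARD('p) 2))) / (\<epsilon> * lam * sqrt (real n))" .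
    moreover have "1 - prob A \<le> prob G"
      unfolding prob_compl[OF A(1), symmetric] using G G_sup by (intro finite_measure_mono) auto
    ultimately show ?thesis by linarith
  qed
  define K where "K = 8 * (8 + 2 * \<epsilon>) * L * sqrt (ln (real (max CARD('p) 2))) / (\<epsilon> * lam * sqrt (real n))"
  have K: "0 \<le> K"
    using lipschitz(1) margin(1) penalty(1) unfolding K_def by (intro divide_nonneg_nonneg mult_nonneg_nonneg) auto
  have \<sigma>_le: "\<sigma> j \<le> Max (range \<sigma>)" for j by simp
  have Max0: "0 \<le> Max (range \<sigma>)" using subg(1) \<sigma>_le order_trans by blast
  have "1 - K * Max (range \<sigma>) \<le> prob G"
  proof (rule field_le_epsilon)
    fix e :: real assume e: "0 < e"
    \<comment> \<open>Positive variance bounds approach the maximum from above. The denominator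
      \<open>K + 1\<close> is positive even for \<open>K = 0\<close> and keeps the loss below
      \<open>e\<close>.\<close>
    define s where "s = Max (range \<sigma>) + e / (K + 1)"
    have eK: "0 < e / (K + 1)" "K * (e / (K + 1)) \<le> e" using e K by (auto simp: field_simps)
    have "1 - K * s \<le> prob G"
      using main[of s] eK(1) Max0 \<sigma>_le by (simp add: s_def K_def mult_ac add_nonneg_pos add_increasing2)
    then show "1 - K * Max (range \<sigma>) \<le> prob G + e"
      using eK(2) unfolding s_def by (simp add: distrib_left)
  qed
  then show ?thesis by (simp add: K_def G_def mult_ac)
qed

end
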